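(* Suppose that $A_\eta$ is a symmetric random matrix field which is stationary and satisfies the uniform bounds: there exist $\gamma>0$ and $M>0$, independent of $\eta$, such that $\xi^T A_\eta(x,\omega)\xi\ge\gamma|\xi|^2$ for all $\xi\in\mathbb{R}^d$, almost everywhere and almost surely, and $\|A_\eta\|_{(L^\infty(\mathbb{R}^d\times\Omega))^{d\times d}}\le M$. Suppose in addition that $A_\eta = A_{\mathrm{per}}+\eta A_1+R_\eta$ with $A_{\mathrm{per}}\in (L^\infty(Q))^{d\times d}$ deterministic, $A_1\in(L^\infty(Q\times\Omega))^{d\times d}$, that $$\lim_{\eta\to0}\|A_\eta-A_{\mathrm{per}}\|_{(L^\infty(Q\times\Omega))^{d\times d}}=0,\qquad \lim_{\eta\to0}\|\eta^{-1}(A_\eta-A_{\mathrm{per}})-A_1\|_{(L^\infty(Q\times\Omega))^{d\times d}}=0,$$ and that there is a deterministic constant $C_R$ independent of $\eta$ such that $\eta^{-2}\|R_\eta\|_{(L^\infty(Q\times\Omega))^{d\times d}}\le C_R$ whenever $|\eta|\le1$. Let $p\in\mathbb{R}^d$ with $|p|=1$. Then there exists a constant $C$ independent of $\eta$, $\omega$, $N$ and $h$ such that, for $|\eta|\le1$ ($\eta\neq0$), $$\eta^{-2}\left\|\nabla w_p^{\eta,h,N}(\cdot,\omega)-\nabla w_p^{0,h}-\eta\nabla w_p^{1,h,N}(\cdot,\omega)\right\|_{(L^2(Q_N))^d}\le C\sqrt{|Q_N|}\quad\text{almost surely},$$ and $$\eta^{-2}\left|A_\eta^{\star,h,N}(\omega)-A_{\mathrm{per}}^{\star,h}-\eta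 A_1^{\star,h,N}(\omega)\right|\le C\quad\text{almost surely}.$$
   Context: Probabilistic setting: $(\Omega,\mathcal{F},\mathbb{P})$ is a probability space on which the group $(\mathbb{Z}^d,+)$ acts by $(\tau_k)_{k\in\mathbb{Z}^d}$; the action preserves $\mathbb{P}$ and is ergodic (if $\tau_kA=A$ for all $k$ then $\mathbb{P}(A)\in\{0,1\}$). A function $F\in L^1_{\mathrm{loc}}(\mathbb{R}^d,L^1(\Omega))$ is called stationary if for all $k\in\mathbb{Z}^d$, $F(x+k,\omega)=F(x,\tau_k\omega)$ almost everywhere and almost surely. $Q=[-\frac12,\frac12]^d$ and, for $N\in\mathbb{N}$, $Q_N=[-N-\frac12,N+\frac12]^d$. $A_{\mathrm{per}}$ is extended to $\mathbb{R}^d$ by $\mathbb{Z}^d$-periodicity, and $A_1$, $R_\eta$ are extended to $\mathbb{R}^d\times\Omega$ by stationarity. The parameter $\eta$ is a real number. Finite elements: $\mathcal{T}_h^{(Q)}$ is a periodic triangulation of $Q$ of mesh size $h$, $\mathcal{T}_h=\bigcup_{k\in\mathbb{Z}^d}(k+\mathcal{T}_h^{(Q)})$ and $\mathcal{T}_h^N=\mathcal{T}_h\cap Q_N$. $V_h^{\mathrm{per}}(Q_N)$ is the space of functions $\varphi_h$ on $\mathbb{R}^d$ that are $Q_N$-periodic, whose restriction to $Q_N$ belongs to the $\mathbb{P}_1$-Lagrange finite element space built from $\mathcal{T}_h^N$, and with $\int_{Q_N}\varphi_h=0$. $V_h^{\mathrm{per}}(Q)$ is the same space with $Q$ in place of $Q_N$.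 Correctors, for $p\in\mathbb{R}^d$: (i) $w_p^{\eta,h,N}(\cdot,\omega)\in V_h^{\mathrm{per}}(Q_N)$ is the solution of $\int_{Q_N}A_\eta(\cdot,\omega)(p+\nabla w_p^{\eta,h,N}(\cdot,\omega))\cdot\nabla\varphi_h=0$ for all $\varphi_h\in V_h^{\mathrm{per}}(Q_N)$, almost surely. (ii) $w_p^{0,h}\in V_h^{\mathrm{per}}(Q)$ is the solution of $\int_QA_{\mathrm{per}}(p+\nabla w_p^{0,h})\cdot\nabla\varphi_h=0$ for all $\varphi_h\in V_h^{\mathrm{per}}(Q)$. (iii) $w_p^{1,h,N}(\cdot,\omega)\in V_h^{\mathrm{per}}(Q_N)$ is the solution of $\int_{Q_N}A_{\mathrm{per}}\nabla w_p^{1,h,N}(\cdot,\omega)\cdot\nabla\varphi_h+\int_{Q_N}A_1(\cdot,\omega)(p+\nabla w_p^{0,h})\cdot\nabla\varphi_h=0$ for all $\varphi_h\in V_h^{\mathrm{per}}(Q_N)$, almost surely. Matrices, for $1\le i,j\le d$, with $(e_i)$ the canonical basis of $\mathbb{R}^d$: $$[A_\eta^{\star,h,N}]_{ij}(\omega)=\frac1{|Q_N|}\int_{Q_N}e_i^TA_\eta(\cdot,\omega)(e_j+\nabla w_{e_j}^{\eta,h,N}(\cdot,\omega)),\qquad [A_{\mathrm{per}}^{\star,h}]_{ij}=\int_Qe_i^TA_{\mathrm{per}}(e_j+\nabla w_{e_j}^{0,h}),$$ $$[A_1^{\star,h,N}]_{ij}(\omega)=\frac1{|Q_N|}\int_{Q_N}e_i^TA_{\mathrm{per}}\nabla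 w_{e_j}^{1,h,N}(\cdot,\omega)+\frac1{|Q_N|}\int_{Q_N}e_i^TA_1(\cdot,\omega)(\nabla w_{e_j}^{0,h}+e_j).$$ *)

theory Defs
  imports "HOL-Probability.Probability"
begin

section \<open>Lattice, cubes, norms\<close>

definition ivec :: "int ^ 'd \<Rightarrow> real ^ 'd" where
  "ivec k = (\<chi> i. of_int (k $ i))"

definition QN :: "nat \<Rightarrow> (real ^ 'd) set" where
  "QN N = cbox (\<chi> i. - real N - 1/2) (\<chi> i. real N + 1/2)"

abbreviation Q1 :: "(real ^ 'd) set" where
  "Q1 \<equiv> QN 0"

definition vol :: "(real ^ 'd) set \<Rightarrow> real" where
  "vol S = measure lebesgue S"

text \<open>The pointwise norm is the type-class norm; for \<^typ>\<open>real^'d^'d\<close> it is the Frobenius norm.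
  The value is \<open>\<infinity>\<close> for functions that are not essentially bounded.\<close>

definition Linf_norm :: "'a measure \<Rightarrow> ('a \<Rightarrow> 'b::real_normed_vector) \<Rightarrow> ennreal" where
  "Linf_norm M F = esssup M (\<lambda>z. ennreal (norm (F z)))"

definition in_Linf :: "'a measure \<Rightarrow> ('a \<Rightarrow> 'b::real_normed_vector) \<Rightarrow> bool" where
  "in_Linf M F \<longleftrightarrow> F \<in> borel_measurable M \<and> Linf_norm M F < \<infinity>"

definition L2_norm_on :: "(real ^ 'd) set \<Rightarrow> (real ^ 'd \<Rightarrow> real ^ 'd) \<Rightarrow> real" where
  "L2_norm_on S F = sqrt (LINT x:S|lebesgue. (norm (F x))\<^sup>2)"


section \<open>Ergodic action of the lattice and stationary fields\<close>

locale ergodic_lattice_action = prob_space P for P :: "'w measure" +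
  fixes \<tau> :: "int ^ 'd \<Rightarrow> 'w \<Rightarrow> 'w"
  assumes action_zero: "\<omega> \<in> space P \<Longrightarrow> \<tau> 0 \<omega> = \<omega>"
    and action_add: "\<omega> \<in> space P \<Longrightarrow> \<tau> (k + l) \<omega> = \<tau> k (\<tau> l \<omega>)"
    and action_measurable: "\<tau> k \<in> measurable P P"
    and action_preserves: "distr P P (\<tau> k) = P"
    and ergodic: "A \<in> sets P \<Longrightarrow> (\<And>k. \<tau> k ` A = A) \<Longrightarrow> prob A = 0 \<or> prob A = 1"

abbreviation full_space :: "'w measure \<Rightarrow> ((real ^ 'd) \<times> 'w) measure" where
  "full_space P \<equiv> lborel \<Otimes>\<^sub>M P"

abbreviation cell_space :: "'w measure \<Rightarrow> ((real ^ 'd) \<times> 'w) measure" where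
  "cell_space P \<equiv> restrict_space lborel Q1 \<Otimes>\<^sub>M P"

text \<open>The second conjunct says \<open>F \<in> L\<^sup>1\<^sub>l\<^sub>o\<^sub>c(R\<^sup>d, L\<^sup>1(\<Omega>))\<close>.\<close>

definition stationary ::
  "'w measure \<Rightarrow> (int ^ 'd \<Rightarrow> 'w \<Rightarrow> 'w) \<Rightarrow>
     (real ^ 'd \<Rightarrow> 'w \<Rightarrow> 'b::{banach, second_countable_topology}) \<Rightarrow> bool" where
  "stationary P \<tau> F \<longleftrightarrow>
     (\<lambda>(x, \<omega>). F x \<omega>) \<in> borel_measurable (full_space P) \<and>
     (\<forall>K. compact K \<longrightarrow> set_integrable (full_space P) (K \<times> space P) (\<lambda>(x, \<omega>). F x \<omega>)) \<and>
     (\<forall>k. AE (x, \<omega>) in full_space P. F (x + ivec k) \<omega> = F x (\<tau> k \<omega>))"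

text \<open>Invariance is only required almost everywhere, as the periodic extension of a function on
  the closed cube \<open>Q\<close> is determined only up to a null set.\<close>

definition lattice_periodic_ae :: "(real ^ 'd \<Rightarrow> 'b) \<Rightarrow> bool" where
  "lattice_periodic_ae F \<longleftrightarrow> (\<forall>k. AE x in lborel. F (x + ivec k) = F x)"


section \<open>Periodic triangulations and P1 finite elements\<close>

definition periodic_extension :: "(real ^ 'd) set set \<Rightarrow> (real ^ 'd) set set" where
  "periodic_extension T = {(\<lambda>x. ivec k + x) ` K | k K. K \<in> T}"

text \<open>A triangulation of \<open>Q\<close> is periodic if its lattice translates still fit together face to face
  (that is, the traces on opposite faces of \<open>Q\<close> match). The mesh size is the largest element
  diameter.\<close>

definition periodic_triangulation :: "real \<Rightarrow> (real ^ 'd) set set \<Rightarrow> bool" where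
  "periodic_triangulation h T \<longleftrightarrow>
     triangulation T \<and>
     (\<forall>K\<in>T. int CARD('d) simplex K) \<and>
     \<Union>T = Q1 \<and>
     (\<forall>K\<in>periodic_extension T. \<forall>K'\<in>periodic_extension T. (K \<inter> K') face_of K) \<and>
     h = Max (diameter ` T)"

definition meshN :: "(real ^ 'd) set set \<Rightarrow> nat \<Rightarrow> (real ^ 'd) set set" where
  "meshN T N = {K \<in> periodic_extension T. K \<subseteq> QN N}"

definition P1_Lagrange :: "(real ^ 'd) set \<Rightarrow> (real ^ 'd) set set \<Rightarrow> (real ^ 'd \<Rightarrow> real) set" where
  "P1_Lagrange S \<M> =
     {v. continuous_on S v \<and> (\<forall>K\<in>\<M>. \<exists>a g. \<forall>x\<in>K. v x = a + g \<bullet> x)}"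

text \<open>\<open>Q\<^sub>N\<close> has side \<open>2N+1\<close>, so \<open>Q\<^sub>N\<close>-periodicity is invariance under \<open>(2N+1)Z\<^sup>d\<close>.\<close>

definition Vper :: "(real ^ 'd) set set \<Rightarrow> nat \<Rightarrow> (real ^ 'd \<Rightarrow> real) set" where
  "Vper T N =
     {v. (\<forall>x k. v (x + real (2 * N + 1) *\<^sub>R ivec k) = v x) \<and>
         v \<in> P1_Lagrange (QN N) (meshN T N) \<and>
         (LINT x:QN N|lebesgue. v x) = 0}"

text \<open>For P1 functions this is the piecewise constant gradient away from the skeleton of the mesh.
  On that null set the value is irrelevant; the integrals below are therefore taken with
  respect to the complete measure \<^term>\<open>lebesgue\<close>.\<close>

definition grad :: "(real ^ 'd \<Rightarrow> real) \<Rightarrow> real ^ 'd \<Rightarrow> real ^ 'd" where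
  "grad v x = (\<chi> i. frechet_derivative v (at x) (axis i 1))"


section \<open>Correctors and homogenized matrices\<close>

text \<open>With \<open>B = A\<^sub>\<eta>(\<cdot>,\<omega>)\<close> this is the problem for \<open>w\<^sub>p\<close> at level \<open>\<eta>,h,N\<close>;
  with \<open>B = A\<^sub>p\<^sub>e\<^sub>r\<close> and \<open>N = 0\<close> it is the periodic problem on \<open>Q\<close>.\<close>

definition solves_corrector ::
  "(real ^ 'd) set set \<Rightarrow> nat \<Rightarrow> (real ^ 'd \<Rightarrow> real ^ 'd ^ 'd) \<Rightarrow> real ^ 'd \<Rightarrow>
     (real ^ 'd \<Rightarrow> real) \<Rightarrow> bool" where
  "solves_corrector T N B p w \<longleftrightarrow>
     w \<in> Vper T N \<and>
     (\<forall>\<phi>\<in>Vper T N. (LINT x:QN N|lebesgue. (B x *v (p + grad w x)) \<bullet> grad \<phi> x) = 0)"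

definition solves_corrector1 ::
  "(real ^ 'd) set set \<Rightarrow> nat \<Rightarrow> (real ^ 'd \<Rightarrow> real ^ 'd ^ 'd) \<Rightarrow> (real ^ 'd \<Rightarrow> real ^ 'd ^ 'd) \<Rightarrow>
     real ^ 'd \<Rightarrow> (real ^ 'd \<Rightarrow> real) \<Rightarrow> (real ^ 'd \<Rightarrow> real) \<Rightarrow> bool" where
  "solves_corrector1 T N Aper B1 p w0 w1 \<longleftrightarrow>
     w1 \<in> Vper T N \<and>
     (\<forall>\<phi>\<in>Vper T N.
        (LINT x:QN N|lebesgue. (Aper x *v grad w1 x) \<bullet> grad \<phi> x) +
        (LINT x:QN N|lebesgue. (B1 x *v (p + grad w0 x)) \<bullet> grad \<phi> x) = 0)"

text \<open>In the following, \<open>W p\<close> is the corrector in direction \<open>p\<close>.\<close>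

definition hom_eta ::
  "nat \<Rightarrow> (real ^ 'd \<Rightarrow> real ^ 'd ^ 'd) \<Rightarrow> (real ^ 'd \<Rightarrow> real ^ 'd \<Rightarrow> real) \<Rightarrow> real ^ 'd ^ 'd" where
  "hom_eta N B W =
     (\<chi> i j. 1 / vol (QN N :: (real ^ 'd) set) *
        (LINT x:QN N|lebesgue. axis i 1 \<bullet> (B x *v (axis j 1 + grad (W (axis j 1)) x))))"

definition hom_per ::
  "(real ^ 'd \<Rightarrow> real ^ 'd ^ 'd) \<Rightarrow> (real ^ 'd \<Rightarrow> real ^ 'd \<Rightarrow> real) \<Rightarrow> real ^ 'd ^ 'd" where
  "hom_per Aper W0 =
     (\<chi> i j. LINT x:Q1|lebesgue. axis i 1 \<bullet> (Aper x *v (axis j 1 + grad (W0 (axis j 1)) x)))"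

definition hom_1 ::
  "nat \<Rightarrow> (real ^ 'd \<Rightarrow> real ^ 'd ^ 'd) \<Rightarrow> (real ^ 'd \<Rightarrow> real ^ 'd ^ 'd) \<Rightarrow>
     (real ^ 'd \<Rightarrow> real ^ 'd \<Rightarrow> real) \<Rightarrow> (real ^ 'd \<Rightarrow> real ^ 'd \<Rightarrow> real) \<Rightarrow> real ^ 'd ^ 'd" where
  "hom_1 N Aper B1 W0 W1 =
     (\<chi> i j.
        1 / vol (QN N :: (real ^ 'd) set) *
          (LINT x:QN N|lebesgue. axis i 1 \<bullet> (Aper x *v grad (W1 (axis j 1)) x)) +
        1 / vol (QN N :: (real ^ 'd) set) *
          (LINT x:QN N|lebesgue. axis i 1 \<bullet> (B1 x *v (grad (W0 (axis j 1)) x + axis j 1))))"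

end

theory Submission
  imports Defs
begin

text \<open>Fix a realization and write \<open>A\<close>, \<open>Ap\<close>, \<open>B1\<close>, \<open>R\<close> for the values of \<open>A\<^sub>\<eta>\<close>, the periodic matrix,
  \<open>A\<^sub>1\<close> and \<open>R\<^sub>\<eta>\<close>, and \<open>w\<close>, \<open>w0\<close>, \<open>w1\<close> for the three correctors. Set \<open>v = w - w0 - \<eta> w1\<close>.
  Substituting \<open>A = Ap + \<eta> B1 + R\<close> in the equation of \<open>w\<close> and subtracting the equations of
  \<open>w0\<close> and \<open>w1\<close>, everything of order zero and one in \<open>\<eta>\<close> cancels, so that \<open>v\<close> solves a
  discrete elliptic problem
    \<open>\<integral> A \<nabla>v \<cdot> \<nabla>\<phi> = - \<integral> (R (p + \<nabla>w0) + \<eta> (\<eta> B1 + R) \<nabla>w1) \<cdot> \<nabla>\<phi>\<close>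
  on \<open>Q\<^sub>N\<close> whose source is of order \<open>\<eta>\<^sup>2\<close>. The function \<open>v\<close> belongs to the finite element
  space, hence it may be taken as a test function, and coercivity bounds \<open>\<nabla>v\<close> by the source. The energy
  estimates of \<open>w0\<close> and \<open>w1\<close> bound the source by \<open>\<eta>\<^sup>2 sqrt |Q\<^sub>N|\<close>, with a constant that
  depends on the ellipticity and boundedness constants only. The same splitting, integrated
  against a unit vector, gives the estimate of the homogenized matrices. This part is pure
  algebra and integration on a finite measure space (\<open>energy_estimate\<close>, \<open>corrector_expansion\<close>).

  Four facts make it applicable. (1) The gradient of a finite element function is essentially
  bounded on \<open>Q\<^sub>N\<close> (\<open>Vper_gradient\<close>). (2) The corrector \<open>w0\<close>, which is defined by an equation on \<open>Q\<close>,
  also solves the equation on \<open>Q\<^sub>N\<close>: a test function \<open>\<phi>\<close> on \<open>Q\<^sub>N\<close> is replaced with its folding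
  \<open>\<Sum>\<^sub>k \<phi>(\<cdot> + k)\<close> over the unit cells of \<open>Q\<^sub>N\<close>, which is a test function on \<open>Q\<close>
  (\<open>periodic_corrector_tested\<close>). (3) By stationarity and invariance of the probability,
  bounds on the cell \<open>Q\<close> hold almost surely on \<open>Q\<^sub>N\<close> (\<open>stationary_bound\<close>). (4) The periodic matrix is coercive, as it differs
  by at most half of the coercivity constant from \<open>A\<^sub>\<eta>\<close> with a suitable small \<open>\<eta>\<close>.\<close>

section \<open>Essentially bounded fields\<close>

lemma in_Linf_iff:
  "in_Linf M F \<longleftrightarrow> F \<in> borel_measurable M \<and> (\<exists>B. AE z in M. norm (F z) \<le> B)"
proof
  assume L: "in_Linf M F"
  let ?e = "Linf_norm M F"
  have "AE z in M. ennreal (norm (F z)) \<le> ?e"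
    unfolding Linf_norm_def by (rule esssup_AE)
  moreover have "?e = ennreal (enn2real ?e)"
    using L by (simp add: in_Linf_def)
  ultimately have "AE z in M. norm (F z) \<le> enn2real ?e"
    by (metis (mono_tags, lifting) AE_mp AE_I2 ennreal_le_iff enn2real_nonneg)
  with L show "F \<in> borel_measurable M \<and> (\<exists>B. AE z in M. norm (F z) \<le> B)"
    by (auto simp: in_Linf_def)
next
  assume "F \<in> borel_measurable M \<and> (\<exists>B. AE z in M. norm (F z) \<le> B)"
  then obtain B where F [measurable]: "F \<in> borel_measurable M" and B: "AE z in M. norm (F z) \<le> B"
    by blast
  have "Linf_norm M F \<le> ennreal B"
    unfolding Linf_norm_def using B by (intro esssup_I) (auto simp: ennreal_leI)
  then show "in_Linf M F"
    using F by (auto simp: in_Linf_def intro: le_less_trans)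
qed

text \<open>The maximum with \<open>0\<close> is needed because \<^term>\<open>ennreal B\<close> is \<open>0\<close> for negative \<open>B\<close>.\<close>

lemma Linf_norm_AE:
  assumes "Linf_norm M F \<le> ennreal B"
  shows "AE z in M. norm (F z) \<le> max 0 B"
proof -
  have "AE z in M. ennreal (norm (F z)) \<le> Linf_norm M F"
    unfolding Linf_norm_def by (rule esssup_AE)
  then show ?thesis
  proof (rule AE_mp, intro AE_I2 impI)
    fix z assume "ennreal (norm (F z)) \<le> Linf_norm M F"
    also have "\<dots> \<le> ennreal (max 0 B)"
      using assms by (cases "0 \<le> B") (auto simp: max_def ennreal_neg)
    finally show "norm (F z) \<le> max 0 B"
      by (subst (asm) ennreal_le_iff) auto
  qed
qed

lemma in_Linf_const [simp]: "in_Linf M (\<lambda>x. c)"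
  by (auto simp: in_Linf_iff)

lemma in_Linf_measurable: "in_Linf M F \<Longrightarrow> F \<in> borel_measurable M"
  by (simp add: in_Linf_def)

lemma in_Linf_add:
  fixes F G :: "'a \<Rightarrow> 'b::{real_normed_vector, second_countable_topology}"
  assumes "in_Linf M F" "in_Linf M G" shows "in_Linf M (\<lambda>x. F x + G x)"
proof -
  from assms obtain B C where "AE z in M. norm (F z) \<le> B" "AE z in M. norm (G z) \<le> C"
    by (auto simp: in_Linf_iff)
  then have "AE z in M. norm (F z + G z) \<le> B + C"
    by eventually_elim (metis add_mono norm_triangle_le)
  then show ?thesis
    using assms by (auto simp: in_Linf_iff)
qed

lemma norm_matrix_vector_le:
  fixes B :: "real ^ 'n ^ 'm"
  shows "norm (B *v x) \<le> norm B * norm x"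
proof -
  have "norm (B *v x) = L2_set (\<lambda>i. norm (B $ i \<bullet> x)) UNIV"
    by (simp add: norm_vec_def matrix_vector_mul_component)
  also have "\<dots> \<le> L2_set (\<lambda>i. norm (B $ i) * norm x) UNIV"
    by (intro L2_set_mono) (auto simp: Cauchy_Schwarz_ineq2)
  also have "\<dots> = norm B * norm x"
    by (simp add: norm_vec_def L2_set_left_distrib)
  finally show ?thesis .
qed

lemma norm_matrix_vector_bound:
  fixes B :: "real ^ 'n ^ 'm"
  assumes "norm B \<le> b" shows "norm (B *v x) \<le> b * norm x"
  using norm_matrix_vector_le mult_right_mono[OF assms norm_ge_zero] by (rule order_trans)

lemma bounded_bilinear_matrix_vector:
  "bounded_bilinear (\<lambda>(B :: real ^ 'n ^ 'm) x. B *v x)"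
proof
  show "\<exists>K. \<forall>B x. norm ((B :: real ^ 'n ^ 'm) *v x) \<le> norm B * norm x * K"
    by (intro exI[of _ 1]) (simp add: norm_matrix_vector_le)
qed (simp_all add: matrix_vector_mult_add_rdistrib matrix_vector_right_distrib
       scaleR_matrix_vector_assoc[symmetric] matrix_vector_mult_scaleR)

lemma in_Linf_bilinear:
  fixes prod :: "'a::{real_normed_vector, second_countable_topology} \<Rightarrow>
    'b::{real_normed_vector, second_countable_topology} \<Rightarrow> 'c::{real_normed_vector, second_countable_topology}"
  assumes "bounded_bilinear prod" "in_Linf M F" "in_Linf M G"
  shows "in_Linf M (\<lambda>x. prod (F x) (G x))"
proof -
  interpret bounded_bilinear prod by fact
  obtain K where K: "\<And>a b. norm (prod a b) \<le> norm a * norm b * K" "K \<ge> 0"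
    using nonneg_bounded by blast
  from assms obtain B C where "AE z in M. norm (F z) \<le> B" "AE z in M. norm (G z) \<le> C"
    by (auto simp: in_Linf_iff)
  then have "AE z in M. norm (prod (F z) (G z)) \<le> B * C * K"
  proof eventually_elim
    case (elim z)
    have "norm (prod (F z) (G z)) \<le> norm (F z) * norm (G z) * K" by (rule K)
    also have "\<dots> \<le> B * C * K"
      using elim K(2) by (intro mult_mono) (auto intro: mult_nonneg_nonneg order_trans[OF norm_ge_zero])
    finally show ?case .
  qed
  moreover have "(\<lambda>x. prod (F x) (G x)) \<in> borel_measurable M"
    using assms(2,3)
    by (intro borel_measurable_continuous_Pair[of F M G prod]) (auto simp: in_Linf_def intro!: continuous_on continuous_on_fst continuous_on_snd continuous_on_id)
  ultimately show ?thesis by (auto simp: in_Linf_iff)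
qed

lemmas in_Linf_scaleR = in_Linf_bilinear[OF bounded_bilinear_scaleR]
lemmas in_Linf_mult = in_Linf_bilinear[OF bounded_bilinear_mult]
lemmas in_Linf_inner = in_Linf_bilinear[OF bounded_bilinear_inner]
lemmas in_Linf_matrix_vector = in_Linf_bilinear[OF bounded_bilinear_matrix_vector]

lemma in_Linf_minus:
  fixes F :: "'a \<Rightarrow> 'b::{real_normed_vector, second_countable_topology}"
  assumes "in_Linf M F" shows "in_Linf M (\<lambda>x. - F x)"
  using assms by (auto simp: in_Linf_iff)

lemma in_Linf_diff:
  fixes F G :: "'a \<Rightarrow> 'b::{real_normed_vector, second_countable_topology}"
  assumes "in_Linf M F" "in_Linf M G" shows "in_Linf M (\<lambda>x. F x - G x)"
  using in_Linf_add[OF assms(1) in_Linf_minus[OF assms(2)]] by simp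

lemma in_Linf_sum:
  fixes F :: "'i \<Rightarrow> 'a \<Rightarrow> 'b::{real_normed_vector, second_countable_topology}"
  assumes "\<And>i. i \<in> I \<Longrightarrow> in_Linf M (F i)" shows "in_Linf M (\<lambda>x. \<Sum>i\<in>I. F i x)"
proof (cases "finite I")
  case True
  from this assms show ?thesis by induction (auto intro!: in_Linf_add)
qed simp

lemma in_Linf_norm:
  fixes F :: "'a \<Rightarrow> 'b::{real_normed_vector, second_countable_topology}"
  assumes "in_Linf M F" shows "in_Linf M (\<lambda>x. norm (F x))"
  using assms by (auto simp: in_Linf_iff)

lemma in_Linf_power2:
  assumes "in_Linf M F" shows "in_Linf M (\<lambda>x. (F x :: real)\<^sup>2)"
  using in_Linf_mult[OF assms assms] by (simp add: power2_eq_square)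

lemmas in_Linf_intros = in_Linf_const in_Linf_add in_Linf_diff in_Linf_minus in_Linf_scaleR
  in_Linf_mult in_Linf_inner in_Linf_matrix_vector in_Linf_norm in_Linf_power2

lemma (in finite_measure) in_Linf_integrable:
  fixes F :: "'a \<Rightarrow> 'b::{banach, second_countable_topology}"
  assumes "in_Linf M F" shows "integrable M F"
  using assms by (auto simp: in_Linf_iff intro: integrable_const_bound)

section \<open>Second-order expansion on a finite measure space\<close>

lemma sq_norm_add_le:
  fixes a b :: "'a::real_inner"
  shows "(norm (a + b))\<^sup>2 \<le> 2 * (norm a)\<^sup>2 + 2 * (norm b)\<^sup>2"
proof -
  have "(norm (a + b))\<^sup>2 + (norm (a - b))\<^sup>2 = 2 * (norm a)\<^sup>2 + 2 * (norm b)\<^sup>2"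
    by (simp add: power2_norm_eq_inner inner_diff inner_add inner_commute)
  then show ?thesis by (smt (verit) zero_le_power2)
qed

text \<open>The solution \<open>g\<close> of the energy identity with source \<open>f\<close> satisfies \<open>c \<parallel>g\<parallel> \<le> \<parallel>f\<parallel>\<close> in \<open>L\<^sup>2\<close>, here for
  the squared norms. Young's inequality is applied pointwise, so that no Cauchy-Schwarz
  inequality for integrals is needed.\<close>

lemma (in finite_measure) energy_estimate:
  fixes B :: "'a \<Rightarrow> real ^ 'd ^ 'd" and f g :: "'a \<Rightarrow> real ^ 'd"
  assumes c: "c > 0"
    and B: "in_Linf M B" and f: "in_Linf M f" and g: "in_Linf M g"
    and coercive: "AE x in M. \<forall>\<xi>. c * (norm \<xi>)\<^sup>2 \<le> \<xi> \<bullet> (B x *v \<xi>)"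
    and eq: "(LINT x|M. (B x *v g x) \<bullet> g x) + (LINT x|M. f x \<bullet> g x) = 0"
  shows "(LINT x|M. (norm (g x))\<^sup>2) \<le> (LINT x|M. (norm (f x))\<^sup>2) / c\<^sup>2"
proof -
  have ig: "integrable M (\<lambda>x. (norm (g x))\<^sup>2)" and iF: "integrable M (\<lambda>x. (norm (f x))\<^sup>2)"
    by (intro in_Linf_integrable in_Linf_intros f g)+
  have iB: "integrable M (\<lambda>x. (B x *v g x) \<bullet> g x)" and ifg: "integrable M (\<lambda>x. f x \<bullet> g x)"
    by (intro in_Linf_integrable in_Linf_intros B f g)+
  have young: "- (a \<bullet> b) \<le> c / 2 * (norm b)\<^sup>2 + 1 / (2 * c) * (norm a)\<^sup>2" for a b :: "real ^ 'd"
  proof -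
    have "0 \<le> (norm (a + c *\<^sub>R b))\<^sup>2 / (2 * c)" using c by simp
    also have "\<dots> = a \<bullet> b + c / 2 * (norm b)\<^sup>2 + 1 / (2 * c) * (norm a)\<^sup>2"
      using c unfolding power2_norm_eq_inner
      by (simp add: inner_add_left inner_add_right inner_commute field_simps)
    finally show ?thesis by simp
  qed
  have "c * (LINT x|M. (norm (g x))\<^sup>2) = (LINT x|M. c * (norm (g x))\<^sup>2)" by simp
  also have "\<dots> \<le> (LINT x|M. (B x *v g x) \<bullet> g x)"
    using coercive ig iB by (intro integral_mono_AE) (auto simp: inner_commute)
  also have "\<dots> = (LINT x|M. - (f x \<bullet> g x))"
    using eq ifg by simp
  also have "\<dots> \<le> (LINT x|M. c / 2 * (norm (g x))\<^sup>2 + 1 / (2 * c) * (norm (f x))\<^sup>2)"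
    using young ig iF ifg by (intro integral_mono) auto
  also have "\<dots> = c / 2 * (LINT x|M. (norm (g x))\<^sup>2) + 1 / (2 * c) * (LINT x|M. (norm (f x))\<^sup>2)"
    using ig iF by simp
  finally show ?thesis using c by (simp add: field_simps power2_eq_square)
qed

text \<open>The weight \<open>e\<close> will be the expansion parameter: it balances a squared norm of order \<open>e\<^sup>4\<close> against
  a constant, both terms then being of order \<open>e\<^sup>2\<close>.\<close>

lemma weighted_young:
  fixes s t e :: real
  assumes "e \<noteq> 0" shows "s * t \<le> s\<^sup>2 / 2 * e\<^sup>2 + 1 / (2 * e\<^sup>2) * t\<^sup>2"
proof -
  have "(s * e) * (t / e) = s * t" using assms by simp
  moreover have "2 * (s * e) * (t / e) \<le> (s * e)\<^sup>2 + (t / e)\<^sup>2" by (rule sum_squares_bound)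
  ultimately show ?thesis using assms by (simp add: power_mult_distrib power_divide)
qed

text \<open>With coercivity constant \<open>c\<close> and bound \<open>m\<close> on the coefficients, the squared \<open>L\<^sup>2\<close> norm of the source of
  the equation of the remainder is at most \<^term>\<open>source_const c m\<close> times \<open>\<eta>\<^sup>4\<close> times the volume.
  Here \<open>a\<close> is the constant for \<open>p + g0\<close> and \<open>m\<^sup>2 / c\<^sup>2 * a\<close> that for \<open>g1\<close>.\<close>

definition source_const :: "real \<Rightarrow> real \<Rightarrow> real" where
  "source_const c m = (let a = 2 * (1 + m\<^sup>2 / c\<^sup>2) in 2 * m\<^sup>2 * (a + 4 * (m\<^sup>2 / c\<^sup>2 * a)))"

text \<open>The fields \<open>gw\<close>, \<open>g0\<close>, \<open>g1\<close> stand for the gradients of the three correctors. The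
  weak equations are assumed only for the test functions that the proof uses: the remainder
  \<open>v\<close>, and in the second equations of \<open>eq0\<close> and \<open>eq1\<close> the corrector itself.\<close>

lemma (in finite_measure) corrector_expansion:
  fixes A Ap B1 R :: "'a \<Rightarrow> real ^ 'd ^ 'd" and gw g0 g1 :: "'a \<Rightarrow> real ^ 'd"
    and c m \<eta> :: real
  defines "v \<equiv> \<lambda>x. gw x - g0 x - \<eta> *\<^sub>R g1 x"
  assumes c: "c > 0" and \<eta>: "\<bar>\<eta>\<bar> \<le> 1" "\<eta> \<noteq> 0" and p: "norm p = 1"
    and meas: "in_Linf M A" "in_Linf M Ap" "in_Linf M B1" "in_Linf M R"
    and gmeas: "in_Linf M gw" "in_Linf M g0" "in_Linf M g1"
    and A_coercive: "AE x in M. \<forall>\<xi>. c * (norm \<xi>)\<^sup>2 \<le> \<xi> \<bullet> (A x *v \<xi>)"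
    and Ap_coercive: "AE x in M. \<forall>\<xi>. c * (norm \<xi>)\<^sup>2 \<le> \<xi> \<bullet> (Ap x *v \<xi>)"
    and bounds: "AE x in M. norm (A x) \<le> m" "AE x in M. norm (Ap x) \<le> m"
      "AE x in M. norm (B1 x) \<le> m" "AE x in M. norm (R x) \<le> \<eta>\<^sup>2 * m"
    and expansion: "AE x in M. A x = Ap x + \<eta> *\<^sub>R B1 x + R x"
    and eqw: "(LINT x|M. (A x *v (p + gw x)) \<bullet> v x) = 0"
    and eq0: "(LINT x|M. (Ap x *v (p + g0 x)) \<bullet> v x) = 0" "(LINT x|M. (Ap x *v (p + g0 x)) \<bullet> g0 x) = 0"
    and eq1: "(LINT x|M. (Ap x *v g1 x) \<bullet> v x) + (LINT x|M. (B1 x *v (p + g0 x)) \<bullet> v x) = 0"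
      "(LINT x|M. (Ap x *v g1 x) \<bullet> g1 x) + (LINT x|M. (B1 x *v (p + g0 x)) \<bullet> g1 x) = 0"
  shows corrector_expansion_L2:
      "(LINT x|M. (norm (v x))\<^sup>2) \<le> source_const c m / c\<^sup>2 * \<eta>^4 * measure M (space M)"
    and corrector_expansion_flux: "norm e = 1 \<Longrightarrow>
      \<bar>(LINT x|M. e \<bullet> (A x *v (p + gw x))) - (LINT x|M. e \<bullet> (Ap x *v (p + g0 x)))
         - \<eta> * (LINT x|M. e \<bullet> (Ap x *v g1 x)) - \<eta> * (LINT x|M. e \<bullet> (B1 x *v (p + g0 x)))\<bar>
       \<le> (1 + m\<^sup>2 + source_const c m + source_const c m / c\<^sup>2) * \<eta>\<^sup>2 * measure M (space M)"
proof -
  define V where "V = measure M (space M)"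
  define F where "F x = R x *v (p + g0 x) + \<eta> *\<^sub>R ((\<eta> *\<^sub>R B1 x + R x) *v g1 x)" for x
  define a where "a = 2 * (1 + m\<^sup>2 / c\<^sup>2)"
  define b where "b = m\<^sup>2 / c\<^sup>2 * a"
  have s_eq: "source_const c m = 2 * m\<^sup>2 * (a + 4 * b)"
    by (simp add: source_const_def a_def b_def Let_def)
  have Vnn: "V \<ge> 0" by (simp add: V_def)
  have v: "in_Linf M v" and F: "in_Linf M F"
    unfolding v_def F_def by (intro in_Linf_intros meas gmeas)+
  note intros = in_Linf_integrable in_Linf_intros meas gmeas v F
  \<comment> \<open>the energy bound on the periodic corrector\<close>
  have "(LINT x|M. (norm (g0 x))\<^sup>2) \<le> (LINT x|M. (norm (Ap x *v p))\<^sup>2) / c\<^sup>2"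
  proof (rule energy_estimate[OF c meas(2) _ gmeas(2) Ap_coercive])
    show "in_Linf M (\<lambda>x. Ap x *v p)" by (intro intros)
    have "integrable M (\<lambda>x. (Ap x *v g0 x) \<bullet> g0 x)" "integrable M (\<lambda>x. (Ap x *v p) \<bullet> g0 x)"
      by (intro intros)+
    from Bochner_Integration.integral_add[OF this] eq0(2)
    show "(LINT x|M. (Ap x *v g0 x) \<bullet> g0 x) + (LINT x|M. (Ap x *v p) \<bullet> g0 x) = 0"
      by (simp add: matrix_vector_right_distrib inner_add_left add.commute)
  qed
  also have "(LINT x|M. (norm (Ap x *v p))\<^sup>2) \<le> (LINT x|M. m\<^sup>2)"
  proof (rule integral_mono_AE)
    show "AE x in M. (norm (Ap x *v p))\<^sup>2 \<le> m\<^sup>2"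
      using bounds(2)
      by eventually_elim (smt (verit) norm_matrix_vector_le p mult_cancel_left2 norm_ge_zero power_mono mult.commute)
  qed (intro intros)+
  finally have g0: "(LINT x|M. (norm (g0 x))\<^sup>2) \<le> m\<^sup>2 / c\<^sup>2 * V"
    using c by (simp add: V_def field_simps)
  have "(LINT x|M. (norm (p + g0 x))\<^sup>2) \<le> (LINT x|M. 2 + 2 * (norm (g0 x))\<^sup>2)"
    using sq_norm_add_le[of p] by (intro integral_mono intros) (simp add: p)
  also have "\<dots> = 2 * V + 2 * (LINT x|M. (norm (g0 x))\<^sup>2)"
    by (subst Bochner_Integration.integral_add) (auto simp: V_def intro!: intros)
  finally have pg0: "(LINT x|M. (norm (p + g0 x))\<^sup>2) \<le> a * V"
    using g0 unfolding a_def by argo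
  have "(LINT x|M. (norm (g1 x))\<^sup>2) \<le> (LINT x|M. (norm (B1 x *v (p + g0 x)))\<^sup>2) / c\<^sup>2"
    by (rule energy_estimate[OF c meas(2) _ gmeas(3) Ap_coercive eq1(2)]) (intro intros)
  also have "(LINT x|M. (norm (B1 x *v (p + g0 x)))\<^sup>2) \<le> (LINT x|M. m\<^sup>2 * (norm (p + g0 x))\<^sup>2)"
  proof (rule integral_mono_AE)
    show "AE x in M. (norm (B1 x *v (p + g0 x)))\<^sup>2 \<le> m\<^sup>2 * (norm (p + g0 x))\<^sup>2"
      using bounds(3)
    proof eventually_elim
      case (elim x)
      have "norm (B1 x *v (p + g0 x)) \<le> m * norm (p + g0 x)"
        using elim by (rule norm_matrix_vector_bound)
      from power_mono[OF this, of 2] show ?case by (simp add: power_mult_distrib)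
    qed
  qed (intro intros)+
  also have "(LINT x|M. m\<^sup>2 * (norm (p + g0 x))\<^sup>2) = m\<^sup>2 * (LINT x|M. (norm (p + g0 x))\<^sup>2)" by simp
  also have "\<dots> \<le> m\<^sup>2 * (a * V)" by (intro mult_left_mono pg0) simp
  finally have g1: "(LINT x|M. (norm (g1 x))\<^sup>2) \<le> b * V"
    using c by (simp add: b_def divide_right_mono)
  \<comment> \<open>the source of the equation of the remainder is of second order in \<open>\<eta>\<close>\<close>
  have "(LINT x|M. (norm (F x))\<^sup>2) \<le> (LINT x|M. 2 * m\<^sup>2 * \<eta>^4 * ((norm (p + g0 x))\<^sup>2 + 4 * (norm (g1 x))\<^sup>2))"
  proof (rule integral_mono_AE)
    show "AE x in M. (norm (F x))\<^sup>2 \<le> 2 * m\<^sup>2 * \<eta>^4 * ((norm (p + g0 x))\<^sup>2 + 4 * (norm (g1 x))\<^sup>2)"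
      using bounds(3,4)
    proof eventually_elim
      case (elim x)
      have 1: "norm (R x *v (p + g0 x)) \<le> \<eta>\<^sup>2 * m * norm (p + g0 x)"
        using elim(2) by (rule norm_matrix_vector_bound)
      have "\<bar>\<eta>\<bar> * norm (\<eta> *\<^sub>R B1 x + R x) \<le> \<bar>\<eta>\<bar> * (\<bar>\<eta>\<bar> * norm (B1 x) + norm (R x))"
        by (intro mult_left_mono norm_triangle_le) auto
      also have "\<dots> = \<eta>\<^sup>2 * norm (B1 x) + \<bar>\<eta>\<bar> * norm (R x)"
        by (simp add: distrib_left power2_eq_square flip: mult.assoc)
      also have "\<dots> \<le> \<eta>\<^sup>2 * m + 1 * (\<eta>\<^sup>2 * m)"
        using elim \<eta> by (intro add_mono mult_left_mono mult_mono) auto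
      finally have eq2: "\<bar>\<eta>\<bar> * norm (\<eta> *\<^sub>R B1 x + R x) \<le> 2 * \<eta>\<^sup>2 * m" by (simp add: mult_ac)
      have 2: "norm (\<eta> *\<^sub>R ((\<eta> *\<^sub>R B1 x + R x) *v g1 x)) \<le> 2 * \<eta>\<^sup>2 * m * norm (g1 x)"
      proof -
        have "norm (\<eta> *\<^sub>R ((\<eta> *\<^sub>R B1 x + R x) *v g1 x))
            \<le> \<bar>\<eta>\<bar> * (norm (\<eta> *\<^sub>R B1 x + R x) * norm (g1 x))"
          unfolding norm_scaleR by (intro mult_left_mono norm_matrix_vector_le) simp
        also have "\<dots> \<le> 2 * \<eta>\<^sup>2 * m * norm (g1 x)"
          using eq2 unfolding mult.assoc[symmetric] by (rule mult_right_mono) simp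
        finally show ?thesis .
      qed
      have "(norm (F x))\<^sup>2 \<le> 2 * (norm (R x *v (p + g0 x)))\<^sup>2
          + 2 * (norm (\<eta> *\<^sub>R ((\<eta> *\<^sub>R B1 x + R x) *v g1 x)))\<^sup>2"
        unfolding F_def by (rule sq_norm_add_le)
      also have "\<dots> \<le> 2 * (\<eta>\<^sup>2 * m * norm (p + g0 x))\<^sup>2 + 2 * (2 * \<eta>\<^sup>2 * m * norm (g1 x))\<^sup>2"
        by (intro add_mono mult_left_mono power_mono 1 2) auto
      also have "\<dots> = 2 * m\<^sup>2 * \<eta>^4 * ((norm (p + g0 x))\<^sup>2 + 4 * (norm (g1 x))\<^sup>2)"
        by (simp add: power_mult_distrib algebra_simps flip: power_mult)
      finally show ?case .
    qed
  qed (intro intros)+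
  also have "\<dots> = 2 * m\<^sup>2 * \<eta>^4 * ((LINT x|M. (norm (p + g0 x))\<^sup>2) + 4 * (LINT x|M. (norm (g1 x))\<^sup>2))"
    by (subst integral_mult_right_zero, subst Bochner_Integration.integral_add) (auto intro!: intros)
  also have "\<dots> \<le> 2 * m\<^sup>2 * \<eta>^4 * (a * V + 4 * (b * V))"
    using pg0 g1 by (intro mult_left_mono add_mono) auto
  finally have F2: "(LINT x|M. (norm (F x))\<^sup>2) \<le> source_const c m * \<eta>^4 * V"
    by (simp add: s_eq algebra_simps)
  \<comment> \<open>the terms of order zero and one in \<open>\<eta>\<close> are absorbed in the three corrector equations\<close>
  have split: "AE x in M. A x *v (p + gw x) - Ap x *v (p + g0 x) - \<eta> *\<^sub>R (Ap x *v g1 x)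
      - \<eta> *\<^sub>R (B1 x *v (p + g0 x)) = A x *v v x + F x"
    using expansion
  proof eventually_elim
    case (elim x)
    have "p + gw x = v x + (p + g0 x) + \<eta> *\<^sub>R g1 x" by (simp add: v_def)
    then show ?case
      unfolding elim F_def
      by (simp only: matrix_vector_right_distrib matrix_vector_mult_add_rdistrib)
        (simp add: matrix_vector_mult_scaleR scaleR_matrix_vector_assoc[symmetric] algebra_simps
          matrix_vector_mult_add_rdistrib)
  qed
  have "(LINT x|M. (norm (v x))\<^sup>2) \<le> (LINT x|M. (norm (F x))\<^sup>2) / c\<^sup>2"
  proof (rule energy_estimate[OF c meas(1) F v A_coercive])
    have "(LINT x|M. (A x *v v x) \<bullet> v x) + (LINT x|M. F x \<bullet> v x)
        = (LINT x|M. (A x *v v x + F x) \<bullet> v x)"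
      unfolding inner_add_left by (subst Bochner_Integration.integral_add) (auto intro!: intros)
    also have "\<dots> = (LINT x|M. (A x *v (p + gw x)) \<bullet> v x - (Ap x *v (p + g0 x)) \<bullet> v x
       - \<eta> * ((Ap x *v g1 x) \<bullet> v x) - \<eta> * ((B1 x *v (p + g0 x)) \<bullet> v x))"
    proof (rule integral_cong_AE)
      show "AE x in M. (A x *v v x + F x) \<bullet> v x = (A x *v (p + gw x)) \<bullet> v x - (Ap x *v (p + g0 x)) \<bullet> v x
         - \<eta> * ((Ap x *v g1 x) \<bullet> v x) - \<eta> * ((B1 x *v (p + g0 x)) \<bullet> v x)"
        using split
      proof eventually_elim
        case (elim x)
        show ?case by (simp add: elim[symmetric] inner_diff_left)
      qed
    qed (rule in_Linf_measurable, intro in_Linf_intros meas gmeas v F)+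
    also have "\<dots> = (LINT x|M. (A x *v (p + gw x)) \<bullet> v x) - (LINT x|M. (Ap x *v (p + g0 x)) \<bullet> v x)
       - \<eta> * (LINT x|M. (Ap x *v g1 x) \<bullet> v x) - \<eta> * (LINT x|M. (B1 x *v (p + g0 x)) \<bullet> v x)"
      by (subst Bochner_Integration.integral_diff; (subst Bochner_Integration.integral_diff)?;
          (subst Bochner_Integration.integral_diff)?) (auto intro!: intros)
    also have "\<dots> = 0" using eqw eq0(1) eq1(1) by algebra
    finally show "(LINT x|M. (A x *v v x) \<bullet> v x) + (LINT x|M. F x \<bullet> v x) = 0" .
  qed
  also have "\<dots> \<le> source_const c m * \<eta>^4 * V / c\<^sup>2" by (intro divide_right_mono F2) simp
  finally show v2: "(LINT x|M. (norm (v x))\<^sup>2) \<le> source_const c m / c\<^sup>2 * \<eta>^4 * measure M (space M)"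
    by (simp add: V_def)
  assume e: "norm e = 1"
  have int: "integrable M (\<lambda>x. e \<bullet> (A x *v (p + gw x)))" "integrable M (\<lambda>x. e \<bullet> (Ap x *v (p + g0 x)))"
    "integrable M (\<lambda>x. e \<bullet> (Ap x *v g1 x))" "integrable M (\<lambda>x. e \<bullet> (B1 x *v (p + g0 x)))"
    by (intro intros)+
  define D where "D x = e \<bullet> (A x *v (p + gw x)) - e \<bullet> (Ap x *v (p + g0 x))
         - \<eta> * (e \<bullet> (Ap x *v g1 x)) - \<eta> * (e \<bullet> (B1 x *v (p + g0 x)))" for x
  have intD: "integrable M D"
    unfolding D_def by (intro intros)
  have D_eq: "(LINT x|M. e \<bullet> (A x *v (p + gw x))) - (LINT x|M. e \<bullet> (Ap x *v (p + g0 x)))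
         - \<eta> * (LINT x|M. e \<bullet> (Ap x *v g1 x)) - \<eta> * (LINT x|M. e \<bullet> (B1 x *v (p + g0 x)))
     = integral\<^sup>L M D"
    unfolding D_def by (simp add: int)
  have "\<bar>integral\<^sup>L M D\<bar> \<le> (LINT x|M. \<bar>D x\<bar>)"
    by (rule integral_abs_bound)
  also have "\<dots> \<le> (LINT x|M. (1 + m\<^sup>2) / 2 * \<eta>\<^sup>2 + 1 / (2 * \<eta>\<^sup>2) * ((norm (F x))\<^sup>2 + (norm (v x))\<^sup>2))"
  proof (rule integral_mono_AE)
    show "AE x in M. \<bar>D x\<bar>
       \<le> (1 + m\<^sup>2) / 2 * \<eta>\<^sup>2 + 1 / (2 * \<eta>\<^sup>2) * ((norm (F x))\<^sup>2 + (norm (v x))\<^sup>2)"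
      using split bounds(1)
    proof eventually_elim
      case (elim x)
      have D: "D x = e \<bullet> (A x *v v x + F x)"
        by (simp only: D_def elim(1)[symmetric] inner_diff_right inner_scaleR_right)
      moreover have "\<bar>e \<bullet> (A x *v v x + F x)\<bar> \<le> norm (A x *v v x + F x)"
        using Cauchy_Schwarz_ineq2[of e "A x *v v x + F x"] by (simp only: e mult_1)
      moreover have "norm (A x *v v x + F x) \<le> m * norm (v x) + 1 * norm (F x)"
        using norm_matrix_vector_bound[OF elim(2)] by (intro norm_triangle_le add_mono) auto
      moreover have "m * norm (v x) \<le> m\<^sup>2 / 2 * \<eta>\<^sup>2 + 1 / (2 * \<eta>\<^sup>2) * (norm (v x))\<^sup>2"
        "1 * norm (F x) \<le> 1\<^sup>2 / 2 * \<eta>\<^sup>2 + 1 / (2 * \<eta>\<^sup>2) * (norm (F x))\<^sup>2" 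
        by (rule weighted_young[OF \<eta>(2)])+
      ultimately have "\<bar>e \<bullet> (A x *v v x + F x)\<bar> \<le> m\<^sup>2 / 2 * \<eta>\<^sup>2 + 1 / (2 * \<eta>\<^sup>2) * (norm (v x))\<^sup>2
        + (1\<^sup>2 / 2 * \<eta>\<^sup>2 + 1 / (2 * \<eta>\<^sup>2) * (norm (F x))\<^sup>2)" by linarith
      with D show ?case by (simp add: algebra_simps add_divide_distrib)
    qed
  qed (intro integrable_abs intD intros)+
  also have "\<dots> = (1 + m\<^sup>2) / 2 * \<eta>\<^sup>2 * V + 1 / (2 * \<eta>\<^sup>2) * ((LINT x|M. (norm (F x))\<^sup>2) + (LINT x|M. (norm (v x))\<^sup>2))"
    by (subst Bochner_Integration.integral_add)
      (auto simp: V_def integral_add in_Linf_integrable[OF in_Linf_power2[OF in_Linf_norm[OF F]]]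
         in_Linf_integrable[OF in_Linf_power2[OF in_Linf_norm[OF v]]] intro!: intros)
  also have "\<dots> \<le> (1 + m\<^sup>2) / 2 * \<eta>\<^sup>2 * V + 1 / (2 * \<eta>\<^sup>2) *
      (source_const c m * \<eta>^4 * V + source_const c m / c\<^sup>2 * \<eta>^4 * V)"
    using F2 v2 by (intro add_left_mono mult_left_mono add_mono) (auto simp: V_def)
  also have "\<dots> = (1 + m\<^sup>2 + source_const c m + source_const c m / c\<^sup>2) / 2 * \<eta>\<^sup>2 * V"
    using \<eta>(2) c by (simp add: field_simps power2_eq_square power4_eq_xxxx)
  also have "\<dots> \<le> (1 + m\<^sup>2 + source_const c m + source_const c m / c\<^sup>2) * \<eta>\<^sup>2 * V"
  proof -
    have "0 \<le> source_const c m" using c by (simp add: s_eq a_def b_def)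
    then have pos: "0 \<le> 1 + m\<^sup>2 + source_const c m + source_const c m / c\<^sup>2"
      by (intro add_nonneg_nonneg divide_nonneg_nonneg) auto
    have half: "t / 2 \<le> t" if "0 \<le> t" for t :: real using that by simp
    show ?thesis by (intro mult_right_mono half pos Vnn zero_le_power2)
  qed
  finally show "\<bar>(LINT x|M. e \<bullet> (A x *v (p + gw x))) - (LINT x|M. e \<bullet> (Ap x *v (p + g0 x)))
         - \<eta> * (LINT x|M. e \<bullet> (Ap x *v g1 x)) - \<eta> * (LINT x|M. e \<bullet> (B1 x *v (p + g0 x)))\<bar>
       \<le> (1 + m\<^sup>2 + source_const c m + source_const c m / c\<^sup>2) * \<eta>\<^sup>2 * measure M (space M)"
    unfolding D_eq by (simp add: V_def)
qed

section \<open>Tiling by unit cells\<close>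

text \<open>Lebesgue measure on \<open>Q\<^sub>N\<close>. It is complete, so values on the skeleton of a mesh do not
  affect measurability.\<close>

abbreviation LQ :: "nat \<Rightarrow> (real ^ 'd) measure" where
  "LQ N \<equiv> restrict_space lebesgue (QN N)"

text \<open>The lattice points of \<open>Q\<^sub>N\<close>: the unit cells centred there tile \<open>Q\<^sub>N\<close>.\<close>

definition cells :: "nat \<Rightarrow> (int ^ 'd) set" where
  "cells N = {k. \<forall>i. \<bar>k $ i\<bar> \<le> int N}"

text \<open>The half-open unit cell centred at \<open>k\<close>. Being half-open, distinct tiles are disjoint, which
  the closed cells \<open>k + Q\<close> are not.\<close>

definition tile :: "int ^ 'd \<Rightarrow> (real ^ 'd) set" where
  "tile k = {x. \<forall>i. \<lfloor>x $ i + 1/2\<rfloor> = k $ i}"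

lemma finite_cells: "finite (cells N :: (int ^ 'd) set)"
proof -
  have "cells N \<subseteq> (\<lambda>f. \<chi> i. f i) ` (\<Pi>\<^sub>E i\<in>(UNIV :: 'd set). {- int N..int N})"
  proof
    fix k :: "int ^ 'd" assume "k \<in> cells N"
    then have "(\<lambda>i. k $ i) \<in> (\<Pi>\<^sub>E i\<in>(UNIV :: 'd set). {- int N..int N})"
      by (auto simp: cells_def abs_le_iff minus_le_iff)
    moreover have "k = (\<chi> i. k $ i)" by simp
    ultimately show "k \<in> (\<lambda>f. \<chi> i. f i) ` (\<Pi>\<^sub>E i\<in>(UNIV :: 'd set). {- int N..int N})" by blast
  qed
  then show ?thesis by (rule finite_subset) (intro finite_imageI finite_PiE; simp)
qed

lemma mem_QN: "x \<in> QN N \<longleftrightarrow> (\<forall>i. - real N - 1/2 \<le> x $ i \<and> x $ i \<le> real N + 1/2)"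
  by (simp add: QN_def mem_box_cart)

lemma ivec_nth [simp]: "ivec k $ i = of_int (k $ i)"
  by (simp add: ivec_def)

lemma ivec_add: "ivec (k + l) = ivec k + ivec l"
  by (simp add: vec_eq_iff)

lemma ivec_zero [simp]: "ivec 0 = 0"
  by (simp add: vec_eq_iff)

lemma QN_lebesgue [measurable]: "QN N \<in> sets lebesgue" "QN N \<in> sets lborel"
  by (auto simp: QN_def)

lemma compact_QN: "compact (QN N)"
  by (simp add: QN_def)

lemma emeasure_QN_finite: "emeasure lebesgue (QN N) < \<infinity>"
  unfolding QN_def less_top[symmetric] infinity_ennreal_def by (intro fmeasurableD2 lmeasurable_cbox)

lemma finite_measure_LQ: "finite_measure (LQ N)"
  using emeasure_QN_finite[of N]
  by (intro finite_measureI) (simp add: emeasure_restrict_space less_top del: emeasure_completion)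

lemma measure_LQ: "measure (LQ N) (QN N :: (real ^ 'd) set) = vol (QN N :: (real ^ 'd) set)"
  unfolding vol_def by (rule measure_restrict_space) auto

lemma integral_LQ: "(LINT x:QN N|lebesgue. f x) = (LINT x|LQ N. f x)"
  for f :: "real ^ 'd \<Rightarrow> 'b::{banach, second_countable_topology}"
  by (simp add: set_lebesgue_integral_def integral_restrict_space)

lemma integrable_LQ: "set_integrable lebesgue (QN N) f \<longleftrightarrow> integrable (LQ N) f"
  for f :: "real ^ 'd \<Rightarrow> 'b::{banach, second_countable_topology}"
  by (simp add: set_integrable_def integrable_restrict_space)

lemma AE_LQ: "(AE x in LQ N. P x) \<longleftrightarrow> (AE x in lebesgue. x \<in> QN N \<longrightarrow> P x)"
  by (rule AE_restrict_space_iff) simp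

lemma AE_LQ_I: "(AE x in lborel. P x) \<Longrightarrow> AE x in LQ N. P x"
  unfolding AE_LQ by (drule AE_completion) (auto elim: eventually_mono)

lemma distr_lebesgue_shift: "distr lebesgue lebesgue (\<lambda>x. x + a) = (lebesgue :: 'a::euclidean_space measure)"
  and measurable_lebesgue_shift: "(\<lambda>x. x + a) \<in> lebesgue \<rightarrow>\<^sub>M (lebesgue :: 'a::euclidean_space measure)"
proof -
  have eq: "(\<lambda>x. a + (\<Sum>j\<in>Basis. (1 * (x \<bullet> j)) *\<^sub>R j)) = (\<lambda>x. x + a)"
    by (simp add: euclidean_representation add.commute)
  show "distr lebesgue lebesgue (\<lambda>x. x + a) = (lebesgue :: 'a measure)"
    using lebesgue_affine_euclidean[of "\<lambda>_. 1" a] unfolding eq by (simp add: density_1)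
  show "(\<lambda>x. x + a) \<in> lebesgue \<rightarrow>\<^sub>M (lebesgue :: 'a measure)"
    using lebesgue_affine_measurable[of "\<lambda>_. 1" a] unfolding eq by simp
qed

lemma AE_lebesgue_shift:
  fixes a :: "'a::euclidean_space"
  assumes "AE x in lebesgue. P x" shows "AE x in lebesgue. P (x + a)"
proof -
  have "AE x in distr lebesgue lebesgue (\<lambda>x. x + a). P x"
    unfolding distr_lebesgue_shift by (rule assms)
  then show ?thesis by (rule AE_distrD[OF measurable_lebesgue_shift])
qed

lemma integral_lebesgue_shift:
  fixes a :: "'a::euclidean_space" and f :: "'a \<Rightarrow> 'b::{banach, second_countable_topology}"
  assumes "f \<in> borel_measurable lebesgue"
  shows "(LINT x|lebesgue. f (x + a)) = (LINT x|lebesgue. f x)"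
  using integral_distr[OF measurable_lebesgue_shift assms, of a] unfolding distr_lebesgue_shift by simp

lemma QN_shift:
  assumes "x \<in> Q1" "k \<in> cells N" shows "x + ivec k \<in> QN N"
  unfolding mem_QN
proof
  fix i
  have "\<bar>k $ i\<bar> \<le> int N" using assms(2) by (simp add: cells_def)
  then have "\<bar>real_of_int (k $ i)\<bar> \<le> real N" by linarith
  then show "- real N - 1 / 2 \<le> (x + ivec k) $ i \<and> (x + ivec k) $ i \<le> real N + 1 / 2"
    using assms(1)[unfolded mem_QN, rule_format, of i] by simp linarith
qed

lemma QN_cover:
  assumes "x \<in> QN N" obtains k where "k \<in> cells N" "x - ivec k \<in> Q1"
proof
  \<comment> \<open>the minimum takes care of the faces \<open>x $ i = N + 1/2\<close>, where rounding would leave the cells of \<open>Q\<^sub>N\<close>\<close>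
  let ?k = "\<chi> i. min (int N) \<lfloor>x $ i + 1/2\<rfloor>"
  have b: "- real N - 1/2 \<le> x $ i" "x $ i \<le> real N + 1/2" for i
    using assms by (auto simp: mem_QN)
  have f: "- int N \<le> \<lfloor>x $ i + 1/2\<rfloor>" for i
    using b[of i] by (simp add: le_floor_iff)
  show "?k \<in> cells N"
    using f by (auto simp: cells_def abs_le_iff min_def minus_le_iff)
  show "x - ivec ?k \<in> Q1"
    unfolding mem_QN
  proof
    fix i
    show "- real 0 - 1 / 2 \<le> (x - ivec ?k) $ i \<and> (x - ivec ?k) $ i \<le> real 0 + 1 / 2"
      using b[of i] by (simp add: min_def) linarith
  qed
qed

lemma tile_shift: "x + ivec k \<in> tile k \<longleftrightarrow> x \<in> tile 0"
proof -
  have "\<lfloor>x $ i + real_of_int (k $ i) + 1/2\<rfloor> = \<lfloor>x $ i + 1/2\<rfloor> + k $ i" for i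
    unfolding floor_add_int by (rule arg_cong[where f = floor]) simp
  then show ?thesis unfolding tile_def by (simp only: mem_Collect_eq vector_add_component ivec_nth zero_index) simp
qed

lemma tile_sets [measurable]: "tile (k :: int ^ 'd) \<in> sets lebesgue"
proof -
  have "tile k = (\<Inter>i. (\<lambda>x. \<lfloor>x $ i + 1/2\<rfloor>) -` {k $ i} \<inter> space borel)"
    by (auto simp: tile_def)
  also have "\<dots> \<in> sets borel"
  proof (intro sets.finite_INT)
    fix i
    have "(\<lambda>x :: real ^ 'd. x $ i) \<in> borel_measurable borel"
      by (intro borel_measurable_continuous_onI continuous_intros)
    then have "(\<lambda>x :: real ^ 'd. \<lfloor>x $ i + 1/2\<rfloor>) \<in> borel \<rightarrow>\<^sub>M count_space UNIV"
      by measurable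
    then show "(\<lambda>x :: real ^ 'd. \<lfloor>x $ i + 1/2\<rfloor>) -` {k $ i} \<inter> space borel \<in> sets borel"
      by (rule measurable_sets) simp
  qed auto
  finally show ?thesis by (metis sets_completionI_sets sets_lborel)
qed

lemma tile_subset: "k \<in> cells N \<Longrightarrow> tile k \<subseteq> QN N"
proof
  fix x assume k: "k \<in> cells N" and x: "x \<in> tile k"
  show "x \<in> QN N" unfolding mem_QN
  proof
    fix i
    have "\<bar>\<lfloor>x $ i + 1/2\<rfloor>\<bar> \<le> int N" using k x by (simp add: cells_def tile_def)
    then show "- real N - 1 / 2 \<le> x $ i \<and> x $ i \<le> real N + 1 / 2" by linarith
  qed
qed

lemma AE_QN_tiles: "AE x :: real ^ 'd in lebesgue. x \<in> QN N \<longleftrightarrow> x \<in> (\<Union>k\<in>cells N. tile k)"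
proof -
  let ?a = "\<chi> i. - real N - 1/2 ::  real ^ 'd" and ?b = "\<chi> i. real N + 1/2"
  have "cbox ?a ?b - box ?a ?b \<in> null_sets lebesgue"
    using negligible_frontier_interval by (simp add: negligible_iff_null_sets)
  then have "AE x in lebesgue. x \<notin> cbox ?a ?b - box ?a ?b"
    by (rule AE_not_in)
  then show ?thesis
  proof eventually_elim
    case (elim x)
    show ?case
    proof
      assume "x \<in> QN N"
      with elim have x: "- real N - 1/2 < x $ i" "x $ i < real N + 1/2" for i
        by (auto simp: QN_def mem_box_cart)
      have "\<bar>\<lfloor>x $ i + 1/2\<rfloor>\<bar> \<le> int N" for i
        using x[of i] by linarith
      then have "(\<chi> i. \<lfloor>x $ i + 1/2\<rfloor>) \<in> cells N" by (simp add: cells_def)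
      moreover have "x \<in> tile (\<chi> i. \<lfloor>x $ i + 1/2\<rfloor>)" by (simp add: tile_def)
      ultimately show "x \<in> (\<Union>k\<in>cells N. tile k)" by blast
    next
      assume "x \<in> (\<Union>k\<in>cells N. tile k)" then show "x \<in> QN N" using tile_subset by blast
    qed
  qed
qed

lemma set_integral_AE_eq:
  fixes f :: "'a \<Rightarrow> 'b::{banach, second_countable_topology}"
  assumes "set_integrable M A f" "B \<subseteq> A" "B \<in> sets M" "AE x in M. x \<in> A \<longleftrightarrow> x \<in> B"
  shows "(LINT x:A|M. f x) = (LINT x:B|M. f x)"
proof (rule set_integral_cong_set)
  show "set_borel_measurable M A f"
    using assms(1) by (simp add: set_integrable_def set_borel_measurable_def)
  then show "set_borel_measurable M B f"
    by (rule set_borel_measurable_subset) (use assms in auto)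
qed (use assms(4) in auto)

lemma integral_QN_tiles:
  fixes f :: "real ^ 'd \<Rightarrow> 'b::{banach, second_countable_topology}"
  assumes f: "integrable (LQ N) f"
  shows "(LINT x|LQ N. f x) = (\<Sum>k\<in>cells N. LINT x|LQ 0. f (x + ivec k))"
proof -
  have f': "set_integrable lebesgue (QN N) f"
    using f by (simp add: integrable_LQ)
  have sub: "(\<Union>k\<in>cells N. tile k) \<subseteq> QN N" using tile_subset by blast
  have ft: "set_integrable lebesgue (tile k) f" if "k \<in> cells N" for k
    by (rule set_integrable_subset[OF f']) (use that tile_subset in auto)
  have "(LINT x:QN N|lebesgue. f x) = (LINT x:(\<Union>k\<in>cells N. tile k)|lebesgue. f x)"
    by (rule set_integral_AE_eq[OF f' sub _ AE_QN_tiles]) (auto intro: finite_cells)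
  also have "\<dots> = (\<Sum>k\<in>cells N. LINT x:tile k|lebesgue. f x)"
    by (rule set_integral_finite_Union[OF finite_cells _ ft])
      (auto simp: disjoint_family_on_def tile_def vec_eq_iff)
  also have "\<dots> = (\<Sum>k\<in>cells N. LINT x|LQ 0. f (x + ivec k))"
  proof (rule sum.cong[OF refl])
    fix k :: "int ^ 'd" assume k: "k \<in> cells N"
    have m: "(\<lambda>x. indicator (tile k) x *\<^sub>R f x) \<in> borel_measurable lebesgue"
      using ft[OF k] by (simp add: set_integrable_def)
    have "(LINT x:tile k|lebesgue. f x) = (LINT x|lebesgue. indicator (tile k) (x + ivec k) *\<^sub>R f (x + ivec k))"
      using integral_lebesgue_shift[OF m, of "ivec k"] by (simp add: set_lebesgue_integral_def)
    also have "\<dots> = (LINT x:tile 0|lebesgue. f (x + ivec k))"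
      by (simp add: set_lebesgue_integral_def indicator_def tile_shift)
    also have "\<dots> = (LINT x:Q1|lebesgue. f (x + ivec k))"
    proof (rule set_integral_AE_eq[symmetric])
      have "integrable lebesgue (\<lambda>x. indicator (QN N) (x + ivec k) *\<^sub>R f (x + ivec k))"
        using f' integrable_distr[OF measurable_lebesgue_shift, of "ivec k" "\<lambda>x. indicator (QN N) x *\<^sub>R f x"]
        unfolding set_integrable_def distr_lebesgue_shift by blast
      then have "set_integrable lebesgue ((\<lambda>x. x + ivec k) -` QN N \<inter> space lebesgue) (\<lambda>x. f (x + ivec k))"
        by (simp add: set_integrable_def indicator_def)
      then show "set_integrable lebesgue Q1 (\<lambda>x. f (x + ivec k))"
        by (rule set_integrable_subset) (use QN_shift k in auto)
      have c0: "cells 0 = {0 :: int ^ 'd}"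
        by (auto simp: cells_def vec_eq_iff)
      show "tile (0 :: int ^ 'd) \<subseteq> Q1" by (rule tile_subset) (simp add: c0)
      show "AE x in lebesgue. x \<in> Q1 \<longleftrightarrow> x \<in> tile (0 :: int ^ 'd)"
        using AE_QN_tiles[of 0, where 'd = 'd] unfolding c0 by simp
    qed simp
    finally show "(LINT x:tile k|lebesgue. f x) = (LINT x|LQ 0. f (x + ivec k))"
      by (simp add: integral_LQ)
  qed
  finally show ?thesis by (simp add: integral_LQ)
qed

lemma AE_QN_cells:
  assumes "\<And>k. k \<in> cells N \<Longrightarrow> AE x in LQ 0. P (x + ivec k)"
  shows "AE x in LQ N. P x"
proof -
  have "AE x in lebesgue. x - ivec k \<in> Q1 \<longrightarrow> P x" if "k \<in> cells N" for k
    using AE_lebesgue_shift[OF assms[OF that, unfolded AE_LQ], of "- ivec k"] by simp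
  then have "AE x in lebesgue. \<forall>k\<in>cells N. x - ivec k \<in> Q1 \<longrightarrow> P x"
    by (rule AE_finite_allI[OF finite_cells])
  then show ?thesis
    unfolding AE_LQ by eventually_elim (meson QN_cover)
qed

lemma AE_LQ_shift:
  assumes "AE x in LQ N. P x" "k \<in> cells N" shows "AE x in LQ 0. P (x + ivec k)"
  using AE_lebesgue_shift[OF assms(1)[unfolded AE_LQ], of "ivec k"] unfolding AE_LQ
  by eventually_elim (use QN_shift assms(2) in blast)

lemma in_Linf_shift:
  assumes "in_Linf (LQ N) f" "k \<in> cells N" shows "in_Linf (LQ 0) (\<lambda>x. f (x + ivec k))"
proof -
  have "(\<lambda>x. x + ivec k) \<in> LQ 0 \<rightarrow>\<^sub>M LQ N"
    using assms(2) QN_shift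
    by (intro measurable_restrict_space2 measurable_restrict_space1 measurable_lebesgue_shift) auto
  then have "(\<lambda>x. f (x + ivec k)) \<in> borel_measurable (LQ 0)"
    using assms(1) by (auto simp: in_Linf_def intro: measurable_compose)
  moreover obtain B where "AE x in LQ N. norm (f x) \<le> B"
    using assms(1) by (auto simp: in_Linf_iff)
  ultimately show ?thesis
    using AE_LQ_shift[where P="\<lambda>x. norm (f x) \<le> B", OF _ assms(2)] by (auto simp: in_Linf_iff)
qed

lemma vol_Q1: "vol (Q1 :: (real ^ 'd) set) = 1"
proof -
  have "0 \<in> (Q1 :: (real ^ 'd) set)" by (simp add: mem_QN)
  then have "cbox (\<chi> i. - real 0 - 1/2) (\<chi> i. real 0 + 1/2) \<noteq> ({} :: (real ^ 'd) set)"
    unfolding QN_def by blast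
  from content_cbox_cart[OF this] show ?thesis
    by (simp add: vol_def QN_def)
qed

lemma vol_QN: "vol (QN N :: (real ^ 'd) set) = real (card (cells N :: (int ^ 'd) set))"
proof -
  interpret finite_measure "LQ N :: (real ^ 'd) measure" by (rule finite_measure_LQ)
  show ?thesis
    using integral_QN_tiles[of N "\<lambda>_ :: real ^ 'd. 1 :: real"] vol_Q1[where 'd='d]
    by (simp add: measure_LQ)
qed

lemma vol_pos: "vol (QN N :: (real ^ 'd) set) > 0"
proof -
  have "0 \<in> (cells N :: (int ^ 'd) set)" by (simp add: cells_def)
  then show ?thesis using finite_cells[of N, where 'd='d] by (auto simp: vol_QN card_gt_0_iff)
qed

lemma integral_QN_periodic:
  fixes f :: "real ^ 'd \<Rightarrow> real"
  assumes "integrable (LQ N) f" and "\<And>k. k \<in> cells N \<Longrightarrow> AE x in LQ 0. f (x + ivec k) = f x"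
    and f0: "f \<in> borel_measurable (LQ 0)" and fk: "\<And>k. k \<in> cells N \<Longrightarrow> (\<lambda>x. f (x + ivec k)) \<in> borel_measurable (LQ 0)"
  shows "(LINT x|LQ N. f x) = vol (QN N :: (real ^ 'd) set) * (LINT x|LQ 0. f x)"
proof -
  have "(LINT x|LQ N. f x) = (\<Sum>k\<in>cells N. LINT x|LQ 0. f (x + ivec k))"
    by (rule integral_QN_tiles[OF assms(1)])
  also have "\<dots> = (\<Sum>k\<in>(cells N :: (int ^ 'd) set). LINT x|LQ 0. f x)"
    by (intro sum.cong refl integral_cong_AE f0 fk assms(2))
  finally show ?thesis by (simp add: vol_QN)
qed

section \<open>Gradients of piecewise affine functions\<close>

lemma grad_eqI:
  assumes "(v has_derivative D) (at x)" shows "grad v x = (\<chi> i. D (axis i 1))"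
  using frechet_derivative_at[OF assms] by (simp add: grad_def)

lemma has_derivative_grad:
  assumes "v differentiable (at x)" shows "(v has_derivative (\<lambda>h. grad v x \<bullet> h)) (at x)"
proof -
  let ?D = "frechet_derivative v (at x)"
  have D: "(v has_derivative ?D) (at x)" using assms by (simp add: frechet_derivative_works)
  then interpret bounded_linear ?D by (rule has_derivative_bounded_linear)
  have "?D h = grad v x \<bullet> h" for h
  proof -
    have "?D h = ?D (\<Sum>i\<in>UNIV. h $ i *\<^sub>R axis i 1)"
      using basis_expansion[of h] by (simp add: scalar_mult_eq_scaleR)
    also have "\<dots> = grad v x \<bullet> h"
      by (simp add: sum scaleR grad_def inner_vec_def mult.commute)
    finally show ?thesis .
  qed
  then have "?D = (\<lambda>h. grad v x \<bullet> h)" ..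
  with D show ?thesis by simp
qed

lemma grad_inner_eqI:
  assumes "(v has_derivative (\<lambda>h. g \<bullet> h)) (at x)" shows "grad v x = g"
  using grad_eqI[OF assms] by (simp add: vec_eq_iff inner_axis)

lemma has_derivative_shift_iff:
  "((\<lambda>y. v (y + a)) has_derivative D) (at x) \<longleftrightarrow> (v has_derivative D) (at (x + a))"
  for v :: "'a::real_normed_vector \<Rightarrow> 'b::real_normed_vector"
proof -
  have shift: "((\<lambda>y. u (y + b)) has_derivative D) (at z)" if "(u has_derivative D) (at (z + b))"
    for u :: "'a \<Rightarrow> 'b" and b z
  proof -
    have "((\<lambda>y. y + b) has_derivative (\<lambda>h. h)) (at z)"
      using has_derivative_add[OF has_derivative_ident has_derivative_const[of b]] by simp
    from has_derivative_compose[of "\<lambda>y. y + b", OF this that] show ?thesis .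
  qed
  show ?thesis
    using shift[of v x a] shift[of "\<lambda>y. v (y + a)" "x + a" "- a"] by auto
qed

lemma grad_shift: "grad (\<lambda>y. v (y + a)) x = grad v (x + a)"
  by (simp add: grad_def frechet_derivative_def has_derivative_shift_iff)

lemma differentiable_shift: "v differentiable (at (x + a)) \<Longrightarrow> (\<lambda>y. v (y + a)) differentiable (at x)"
  by (auto simp: differentiable_def has_derivative_shift_iff)

lemma grad_sum:
  assumes "\<And>k. k \<in> I \<Longrightarrow> v k differentiable (at x)"
  shows "grad (\<lambda>y. \<Sum>k\<in>I. v k y) x = (\<Sum>k\<in>I. grad (v k) x)"
proof (rule grad_inner_eqI)
  have "((\<lambda>y. \<Sum>k\<in>I. v k y) has_derivative (\<lambda>h. \<Sum>k\<in>I. grad (v k) x \<bullet> h)) (at x)"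
    by (intro has_derivative_sum has_derivative_grad assms)
  then show "((\<lambda>y. \<Sum>k\<in>I. v k y) has_derivative (\<lambda>h. (\<Sum>k\<in>I. grad (v k) x) \<bullet> h)) (at x)"
    by (simp add: inner_sum_left)
qed

lemma grad_diff_scale:
  assumes "u differentiable (at x)" "v differentiable (at x)" "w differentiable (at x)"
  shows "grad (\<lambda>y. u y - v y - c * w y) x = grad u x - grad v x - c *\<^sub>R grad w x"
proof (rule grad_inner_eqI)
  have "((\<lambda>y. u y - v y - c * w y) has_derivative
      (\<lambda>h. grad u x \<bullet> h - grad v x \<bullet> h - c * (grad w x \<bullet> h))) (at x)"
    by (intro has_derivative_diff has_derivative_mult_right has_derivative_grad assms)
  then show "((\<lambda>y. u y - v y - c * w y) has_derivative
      (\<lambda>h. (grad u x - grad v x - c *\<^sub>R grad w x) \<bullet> h)) (at x)"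
    by (simp add: inner_diff_left)
qed

text \<open>Interiors of the pieces cover \<open>S\<close> up to the null set of their frontiers, and the gradient is
  constant on each of them. The pieces may overlap.\<close>

lemma piecewise_affine_gradient:
  fixes v :: "real ^ 'd \<Rightarrow> real"
  assumes fin: "finite \<M>" and S: "S \<in> sets lebesgue" "S \<subseteq> \<Union>\<M>"
    and convex: "\<And>K. K \<in> \<M> \<Longrightarrow> convex K"
    and affine: "\<And>K. K \<in> \<M> \<Longrightarrow> \<exists>a g. \<forall>x\<in>K. v x = a + g \<bullet> x"
  shows "in_Linf (restrict_space lebesgue S) (grad v)"
    and "AE x in restrict_space lebesgue S. v differentiable (at x)"
proof -
  obtain g where g: "\<And>K. K \<in> \<M> \<Longrightarrow> \<exists>a. \<forall>x\<in>K. v x = a + g K \<bullet> x"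
    using affine by metis
  have der: "(v has_derivative (\<lambda>h. g K \<bullet> h)) (at x)" if "K \<in> \<M>" "x \<in> interior K" for K x
  proof -
    obtain a where a: "\<forall>x\<in>K. v x = a + g K \<bullet> x" using g \<open>K \<in> \<M>\<close> by blast
    have "((\<lambda>x. a + g K \<bullet> x) has_derivative (\<lambda>h. g K \<bullet> h)) (at x)"
      by (auto intro!: derivative_eq_intros)
    then show ?thesis
      by (rule has_derivative_transform_within_open[OF _ open_interior that(2)])
        (use a interior_subset[of K] in \<open>auto simp: subset_iff\<close>)
  qed
  define Z where "Z = S - (\<Union>K\<in>\<M>. interior K)"
  have "negligible (\<Union>K\<in>\<M>. frontier K)"
    by (rule negligible_Union) (use fin convex negligible_convex_frontier in blast)+
  moreover have "Z \<subseteq> (\<Union>K\<in>\<M>. frontier K)"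
  proof
    fix x assume x: "x \<in> Z"
    then obtain K where "K \<in> \<M>" "x \<in> K" using S(2) by (auto simp: Z_def)
    with x show "x \<in> (\<Union>K\<in>\<M>. frontier K)"
      using closure_subset[of K] by (auto simp: Z_def frontier_def)
  qed
  ultimately have Z: "negligible Z" by (rule negligible_subset)
  have AE: "AE x in restrict_space lebesgue S. \<exists>K\<in>\<M>. x \<in> interior K"
  proof -
    have "AE x in lebesgue. x \<notin> Z"
      using Z by (intro AE_not_in) (simp add: negligible_iff_null_sets)
    then show ?thesis
      using S by (subst AE_restrict_space_iff) (auto simp: Z_def elim: eventually_mono)
  qed
  from AE show "AE x in restrict_space lebesgue S. v differentiable (at x)"
    by eventually_elim (auto intro: der differentiableI)
  have "AE x in restrict_space lebesgue S. norm (grad v x) \<le> (\<Sum>K\<in>\<M>. norm (g K))"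
    using AE
  proof eventually_elim
    case (elim x)
    then obtain K where K: "K \<in> \<M>" "x \<in> interior K" by blast
    then show ?case
      using grad_inner_eqI[OF der[OF K]] member_le_sum[of K \<M> "\<lambda>K. norm (g K)"] fin by simp
  qed
  moreover have "grad v \<in> borel_measurable (restrict_space lebesgue S)"
  proof (rule measurable_piecewise_restrict[where C = "insert Z ((\<lambda>K. interior K \<inter> S) ` \<M>)"])
    fix \<Omega> assume \<Omega>: "\<Omega> \<in> insert Z ((\<lambda>K. interior K \<inter> S) ` \<M>)"
    have Zs: "A \<in> sets lebesgue" if "A \<subseteq> Z" for A
      using negligible_subset[OF Z that] by (rule negligible_imp_sets)
    have sub: "\<Omega> \<subseteq> S" using \<Omega> by (auto simp: Z_def)
    have int: "interior K \<in> sets lebesgue" for K :: "(real ^ 'd) set"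
      by (simp add: borel_open)
    show "\<Omega> \<inter> space (restrict_space lebesgue S) \<in> sets (restrict_space lebesgue S)"
      using \<Omega> S int Zs[of Z] sub by (auto simp: space_restrict_space sets_restrict_space_iff Int_absorb2)
    show "grad v \<in> borel_measurable (restrict_space (restrict_space lebesgue S) \<Omega>)"
    proof (cases "\<Omega> = Z")
      case True
      show ?thesis
      proof (rule measurableI)
        fix A
        have "grad v -` A \<inter> space (restrict_space (restrict_space lebesgue S) \<Omega>) \<subseteq> Z"
          using True by (auto simp: space_restrict_space)
        moreover have "Z \<subseteq> S" by (auto simp: Z_def)
        ultimately show "grad v -` A \<inter> space (restrict_space (restrict_space lebesgue S) \<Omega>)
            \<in> sets (restrict_space (restrict_space lebesgue S) \<Omega>)"
          using True Zs S by (simp add: restrict_restrict_space sets_restrict_space_iff Int_absorb1)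
      qed simp
    next
      case False
      then obtain K where K: "K \<in> \<M>" "\<Omega> = interior K \<inter> S" using \<Omega> by blast
      have "grad v x = g K" if "x \<in> \<Omega>" for x
        using that K by (intro grad_inner_eqI der) auto
      then show ?thesis
        by (subst measurable_cong[where g = "\<lambda>_. g K"]) (auto simp: space_restrict_space)
    qed
  qed (use fin in \<open>auto simp: Z_def space_restrict_space countable_finite\<close>)
  ultimately show "in_Linf (restrict_space lebesgue S) (grad v)"
    by (auto simp: in_Linf_iff)
qed

section \<open>Finite element functions on \<open>Q\<close> and on \<open>Q\<^sub>N\<close>\<close>

lemma triangulation_pieces:
  assumes T: "periodic_triangulation h (T :: (real ^ 'd) set set)" 
  shows "finite T" "\<Union>T = Q1" and "K \<in> T \<Longrightarrow> convex K" "K \<in> T \<Longrightarrow> K \<subseteq> Q1"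
proof -
  show "finite T" "\<Union>T = Q1" 
    using T by (auto simp: periodic_triangulation_def triangulation_def)
  then show "K \<in> T \<Longrightarrow> K \<subseteq> Q1" by blast
  show "K \<in> T \<Longrightarrow> convex K" 
    using T by (auto simp: periodic_triangulation_def intro: convex_simplex)
qed

lemma meshN_shift:
  assumes "periodic_triangulation h T" "K \<in> T" "k \<in> cells N"
  shows "(\<lambda>x. ivec k + x) ` K \<in> meshN T N"
  using triangulation_pieces(4)[OF assms(1,2)] QN_shift[OF _ assms(3)] assms(2)
  by (auto simp: meshN_def periodic_extension_def add.commute)

lemma Vper_affine:
  assumes "v \<in> Vper T N" "K \<in> meshN T N"
  shows "\<exists>a g. \<forall>x\<in>K. v x = a + g \<bullet> x"
  using assms by (auto simp: Vper_def P1_Lagrange_def)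

lemma Vper_continuous: "v \<in> Vper T N \<Longrightarrow> continuous_on (QN N) v"
  by (auto simp: Vper_def P1_Lagrange_def)

lemma integrable_LQ_continuous: "continuous_on (QN N) f \<Longrightarrow> integrable (LQ N) f"
  for f :: "real ^ 'd \<Rightarrow> real"
  unfolding integrable_LQ[symmetric] unfolding QN_def by (rule absolutely_integrable_continuous)

lemma Vper_integrable: "v \<in> Vper T N \<Longrightarrow> integrable (LQ N) v"
  by (intro integrable_LQ_continuous Vper_continuous)

lemma Vper_mean: "v \<in> Vper T N \<Longrightarrow> (LINT x|LQ N. v x) = 0"
  by (simp add: Vper_def integral_LQ)

lemma Vper_gradient:
  assumes T: "periodic_triangulation h (T :: (real ^ 'd) set set)" and v: "v \<in> Vper T N"
  shows "in_Linf (LQ N) (grad v)" and "AE x in LQ N. v differentiable (at x)"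
proof -
  \<comment> \<open>only the translates of the mesh of \<open>Q\<close> by lattice points of \<open>Q\<^sub>N\<close> are needed; they cover
    \<open>Q\<^sub>N\<close> and form a finite family\<close>
  define \<M> where "\<M> = (\<Union>k\<in>cells N. (\<lambda>K. (\<lambda>x. ivec k + x) ` K) ` T)"
  have fin: "finite \<M>"
    unfolding \<M>_def by (intro finite_UN_I finite_cells finite_imageI triangulation_pieces[OF T])
  have cov: "QN N \<subseteq> \<Union>\<M>"
  proof
    fix x :: "real ^ 'd" assume "x \<in> QN N"
    then obtain k where k: "k \<in> cells N" "x - ivec k \<in> Q1" by (rule QN_cover)
    then obtain K where K: "K \<in> T" "x - ivec k \<in> K"
      using triangulation_pieces(2)[OF T] by blast
    from K(2) have "x \<in> (\<lambda>x. ivec k + x) ` K" by (metis image_eqI add_diff_cancel_left' add_diff_eq)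
    with k K show "x \<in> \<Union>\<M>" by (auto simp: \<M>_def)
  qed
  have cv: "convex K" if "K \<in> \<M>" for K
    using that triangulation_pieces(3)[OF T] by (auto simp: \<M>_def intro!: convex_translation)
  have af: "\<exists>a g. \<forall>x\<in>K. v x = a + g \<bullet> x" if "K \<in> \<M>" for K
    using that by (auto simp: \<M>_def intro!: Vper_affine[OF v] meshN_shift[OF T])
  show "in_Linf (LQ N) (grad v)" "AE x in LQ N. v differentiable (at x)"
    using piecewise_affine_gradient[OF fin QN_lebesgue(1) cov cv af] by auto
qed

lemma Vper_diff_scale:
  assumes "u \<in> Vper T N" "v \<in> Vper T N" "w \<in> Vper T N"
  shows "(\<lambda>x. u x - v x - c * w x) \<in> Vper T N"
proof -
  have "continuous_on (QN N) (\<lambda>x. u x - v x - c * w x)"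
    by (intro continuous_intros Vper_continuous[OF assms(1)] Vper_continuous[OF assms(2)] Vper_continuous[OF assms(3)])
  moreover have "\<exists>a g. \<forall>x\<in>K. u x - v x - c * w x = a + g \<bullet> x" if K: "K \<in> meshN T N" for K
  proof -
    obtain a1 g1 where 1: "\<forall>x\<in>K. u x = a1 + g1 \<bullet> x" using Vper_affine[OF assms(1) K] by blast
    obtain a2 g2 where 2: "\<forall>x\<in>K. v x = a2 + g2 \<bullet> x" using Vper_affine[OF assms(2) K] by blast
    obtain a3 g3 where 3: "\<forall>x\<in>K. w x = a3 + g3 \<bullet> x" using Vper_affine[OF assms(3) K] by blast
    from 1 2 3 have "\<forall>x\<in>K. u x - v x - c * w x = (a1 - a2 - c * a3) + (g1 - g2 - c *\<^sub>R g3) \<bullet> x"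
      by (simp add: inner_diff_left algebra_simps)
    then show ?thesis by blast
  qed
  moreover have "(LINT x|LQ N. u x - v x - c * w x) = 0"
    using assms by (simp add: Vper_integrable Vper_mean)
  moreover have "u (x + real (2 * N + 1) *\<^sub>R ivec k) - v (x + real (2 * N + 1) *\<^sub>R ivec k)
      - c * w (x + real (2 * N + 1) *\<^sub>R ivec k) = u x - v x - c * w x" for x k
    using assms unfolding Vper_def by simp
  ultimately show ?thesis
    by (simp add: Vper_def P1_Lagrange_def integral_LQ)
qed

lemma ivec_scale: "real n *\<^sub>R ivec k = ivec (\<chi> i. int n * k $ i)"
  by (simp add: vec_eq_iff)

lemma Vper_0_periodic: "v \<in> Vper T 0 \<Longrightarrow> v (x + ivec k) = v x"
  by (simp add: Vper_def)

lemma grad_periodic: "v \<in> Vper T 0 \<Longrightarrow> grad v (x + ivec k) = grad v x"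
  by (simp add: grad_shift[symmetric] Vper_0_periodic)

lemma Vper_0_subset:
  assumes T: "periodic_triangulation h (T :: (real ^ 'd) set set)" and v: "v \<in> Vper T 0"
  shows "v \<in> Vper T N"
proof -
  have per: "v (x + ivec k) = v x" for x k using v by (rule Vper_0_periodic)
  have "continuous_on (\<Union>k\<in>cells N. (\<lambda>x. ivec k + x) ` Q1) v"
  proof (rule continuous_on_closed_Union[OF finite_cells])
    fix k :: "int ^ 'd"
    show "closed ((\<lambda>x. ivec k + x) ` Q1)"
      by (intro closed_translation compact_imp_closed compact_QN)
    have "continuous_on ((\<lambda>x. ivec k + x) ` Q1) (\<lambda>x. v (x + - ivec k))"
      by (intro continuous_on_compose2[OF Vper_continuous[OF v]] continuous_intros) auto
    moreover have "v (x + - ivec k) = v x" for x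
      using per[of "x + - ivec k" k] by simp
    ultimately show "continuous_on ((\<lambda>x. ivec k + x) ` Q1) v" by simp
  qed
  moreover have "(QN N :: (real ^ 'd) set) \<subseteq> (\<Union>k\<in>cells N. (\<lambda>x. ivec k + x) ` Q1)"
  proof
    fix x :: "real ^ 'd" assume "x \<in> QN N"
    then obtain k where k: "k \<in> cells N" "x - ivec k \<in> Q1" by (rule QN_cover)
    then show "x \<in> (\<Union>k\<in>cells N. (\<lambda>x. ivec k + x) ` Q1)"
      by (intro UN_I[of k]) (auto intro!: image_eqI[of _ _ "x - ivec k"])
  qed
  ultimately have cont: "continuous_on (QN N) v" by (rule continuous_on_subset)
  have aff: "\<exists>a g. \<forall>x\<in>K. v x = a + g \<bullet> x" if K: "K \<in> meshN T N" for K
  proof -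
    obtain k K0 where k: "K = (\<lambda>x. ivec k + x) ` K0" "K0 \<in> T"
      using K by (auto simp: meshN_def periodic_extension_def)
    have "K0 \<in> meshN T 0"
      using meshN_shift[OF T k(2), of 0 0] by (simp add: cells_def)
    then obtain a g where ag: "\<forall>x\<in>K0. v x = a + g \<bullet> x" using Vper_affine[OF v] by blast
    have "\<forall>x\<in>K. v x = (a - g \<bullet> ivec k) + g \<bullet> x"
      using ag per[of _ k] by (auto simp: k add.commute[of "ivec k"] inner_add_right)
    then show ?thesis by blast
  qed
  from integrable_LQ_continuous[OF cont] have "(LINT x|LQ N. v x) = 0"
    by (simp add: integral_QN_tiles per Vper_mean[OF v])
  then show ?thesis
    using cont aff per by (auto simp: Vper_def P1_Lagrange_def integral_LQ ivec_scale simp del: of_nat_Suc of_nat_add)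
qed

text \<open>The folding of a function on \<open>Q\<^sub>N\<close>: the sum of its translates over the cells of \<open>Q\<^sub>N\<close>. It turns
  \<open>Q\<^sub>N\<close>-periodic test functions into \<open>Q\<close>-periodic ones.\<close>

definition fold_cells :: "nat \<Rightarrow> (real ^ 'd \<Rightarrow> real) \<Rightarrow> real ^ 'd \<Rightarrow> real" where
  "fold_cells N v x = (\<Sum>k\<in>cells N. v (x + ivec k))"

lemma fold_cells_periodic:
  fixes v :: "real ^ 'd \<Rightarrow> real"
  assumes per: "\<And>x k. v (x + real (2 * N + 1) *\<^sub>R ivec k) = v x"
  shows "fold_cells N v (x + ivec l) = fold_cells N v x"
proof -
  \<comment> \<open>translation by \<open>l\<close> permutes the cells modulo \<open>(2N+1)Z\<^sup>d\<close>; \<open>\<pi>\<close> is this permutation, with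
    representatives chosen in \<open>{-N..N}\<close>\<close>
  define n where "n = 2 * int N + 1"
  define \<pi> :: "int ^ 'd \<Rightarrow> int ^ 'd" where "\<pi> k = (\<chi> i. (k $ i + l $ i + int N) mod n - int N)" for k
  have n: "n > 0" by (simp add: n_def)
  have range: "0 \<le> (z + int N) mod n \<and> (z + int N) mod n < n" for z using n by simp
  have into: "\<pi> ` cells N \<subseteq> cells N"
  proof
    fix k' assume "k' \<in> \<pi> ` cells N"
    then obtain k where "k' = \<pi> k" by blast
    then have "\<bar>k' $ i\<bar> \<le> int N" for i
      using range[of "k $ i + l $ i"] by (simp add: \<pi>_def abs_le_iff) (simp add: n_def)
    then show "k' \<in> cells N" by (simp add: cells_def)
  qed
  have inj: "inj_on \<pi> (cells N)"
  proof (rule inj_onI)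
    fix k k' assume k: "k \<in> cells N" "k' \<in> cells N" "\<pi> k = \<pi> k'"
    have "k $ i = k' $ i" for i
    proof -
      have "(k $ i + l $ i + int N) mod n = (k' $ i + l $ i + int N) mod n"
        using k(3) by (simp add: \<pi>_def vec_eq_iff)
      then have "n dvd (k $ i + l $ i + int N) - (k' $ i + l $ i + int N)" by (simp add: mod_eq_dvd_iff)
      then have "n dvd k $ i - k' $ i" by simp
      moreover have "\<bar>k $ i - k' $ i\<bar> < n"
        using k(1,2)[unfolded cells_def mem_Collect_eq, rule_format, of i] by (simp add: n_def abs_le_iff)
      ultimately show ?thesis using zdvd_not_zless[of "\<bar>k $ i - k' $ i\<bar>" n] by (cases "k $ i = k' $ i") auto
    qed
    then show "k = k'" by (simp add: vec_eq_iff)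
  qed
  have bij: "bij_betw \<pi> (cells N) (cells N)"
    using inj into endo_inj_surj[OF finite_cells into inj] by (simp add: bij_betw_def)
  have step: "v (x + ivec l + ivec k) = v (x + ivec (\<pi> k))" for k
  proof -
    have "ivec l + ivec k = ivec (\<pi> k) + real (2 * N + 1) *\<^sub>R ivec (\<chi> i. (k $ i + l $ i + int N) div n)"
    proof (subst vec_eq_iff, rule allI)
      fix i
      have "l $ i + k $ i = \<pi> k $ i + n * ((k $ i + l $ i + int N) div n)"
        by (simp add: \<pi>_def algebra_simps minus_mod_eq_mult_div)
      then have "real_of_int (l $ i + k $ i) = real_of_int (\<pi> k $ i + n * ((k $ i + l $ i + int N) div n))"
        by (rule arg_cong)
      then show "(ivec l + ivec k) $ i = (ivec (\<pi> k) + real (2 * N + 1) *\<^sub>R ivec (\<chi> i. (k $ i + l $ i + int N) div n)) $ i"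
        by (simp add: n_def)
    qed
    then show ?thesis using per[of "x + ivec (\<pi> k)"] by (simp only: add.assoc)
  qed
  have "fold_cells N v (x + ivec l) = (\<Sum>k\<in>cells N. v (x + ivec (\<pi> k)))"
    by (simp add: fold_cells_def step)
  also have "\<dots> = fold_cells N v x"
    unfolding fold_cells_def by (rule sum.reindex_bij_betw[OF bij])
  finally show ?thesis .
qed

lemma fold_cells_Vper:
  assumes T: "periodic_triangulation h (T :: (real ^ 'd) set set)" and v: "v \<in> Vper T N"
  shows "fold_cells N v \<in> Vper T 0"
proof -
  have "fold_cells N v (x + ivec k) = fold_cells N v x" for x k
    using v by (intro fold_cells_periodic) (simp add: Vper_def)
  moreover have "continuous_on Q1 (fold_cells N v)"
    unfolding fold_cells_def
    by (intro continuous_on_sum continuous_on_compose2[OF Vper_continuous[OF v]] continuous_intros)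
      (auto intro: QN_shift)
  moreover have "\<exists>a g. \<forall>x\<in>K. fold_cells N v x = a + g \<bullet> x" if K: "K \<in> meshN T 0" for K
  proof -
    have "\<exists>a g. \<forall>x\<in>K. v (x + ivec k) = a + g \<bullet> x" if k: "k \<in> cells N" for k
    proof -
      obtain l K0 where l: "K = (\<lambda>x. ivec l + x) ` K0" "K0 \<in> T" and sub: "K \<subseteq> Q1"
        using K by (auto simp: meshN_def periodic_extension_def)
      have "(\<lambda>x. ivec k + x) ` K = (\<lambda>x. ivec (k + l) + x) ` K0"
        by (simp add: l image_image ivec_add add.assoc)
      moreover have "(\<lambda>x. ivec k + x) ` K \<subseteq> QN N"
        using sub QN_shift[OF _ k] by (auto simp: add.commute)
      ultimately have "(\<lambda>x. ivec k + x) ` K \<in> meshN T N"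
        using l(2) by (auto simp: meshN_def periodic_extension_def)
      then obtain a g where ag: "\<forall>x\<in>(\<lambda>x. ivec k + x) ` K. v x = a + g \<bullet> x" using Vper_affine[OF v] by blast
      have "\<forall>x\<in>K. v (x + ivec k) = (a + g \<bullet> ivec k) + g \<bullet> x"
        using ag by (auto simp: add.commute[of _ "ivec k"] inner_add_right)
      then show ?thesis by blast
    qed
    then obtain a g where "\<And>k. k \<in> cells N \<Longrightarrow> \<forall>x\<in>K. v (x + ivec k) = a k + g k \<bullet> x" by metis
    then have "\<forall>x\<in>K. fold_cells N v x = (\<Sum>k\<in>cells N. a k) + (\<Sum>k\<in>cells N. g k) \<bullet> x"
      by (simp add: fold_cells_def sum.distrib inner_sum_left)
    then show ?thesis by blast
  qed
  moreover have "(LINT x|LQ 0. fold_cells N v x) = 0"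
  proof -
    have "continuous_on Q1 (\<lambda>x. v (x + ivec k))" if "k \<in> cells N" for k
      by (intro continuous_on_compose2[OF Vper_continuous[OF v]] continuous_intros)
        (auto intro: QN_shift that)
    then have "integrable (LQ 0) (\<lambda>x. v (x + ivec k))" if "k \<in> cells N" for k
      using that by (intro integrable_LQ_continuous)
    then have "(LINT x|LQ 0. fold_cells N v x) = (\<Sum>k\<in>cells N. LINT x|LQ 0. v (x + ivec k))"
      unfolding fold_cells_def by simp
    also have "\<dots> = (LINT x|LQ N. v x)"
      by (rule integral_QN_tiles[symmetric]) (rule Vper_integrable[OF v])
    finally show ?thesis using Vper_mean[OF v] by simp
  qed
  ultimately show ?thesis
    by (simp add: Vper_def P1_Lagrange_def integral_LQ)
qed

lemma grad_fold_cells: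
  assumes T: "periodic_triangulation h (T :: (real ^ 'd) set set)" and v: "v \<in> Vper T N"
  shows "AE x in LQ 0. grad (fold_cells N v) x = (\<Sum>k\<in>cells N. grad v (x + ivec k))"
proof -
  have "AE x in LQ 0. \<forall>k\<in>cells N. v differentiable (at (x + ivec k))"
    by (intro AE_finite_allI finite_cells)
      (rule AE_LQ_shift[where P = "\<lambda>y. v differentiable (at y)", OF Vper_gradient(2)[OF T v]])
  then show ?thesis
  proof eventually_elim
    case (elim x)
    have "grad (\<lambda>y. \<Sum>k\<in>cells N. v (y + ivec k)) x = (\<Sum>k\<in>cells N. grad (\<lambda>y. v (y + ivec k)) x)"
      using elim by (intro grad_sum differentiable_shift) auto
    then show ?case by (simp add: fold_cells_def[abs_def] grad_shift)
  qed
qed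

text \<open>Cell by cell, the flux of \<open>w0\<close> is the same function of \<open>x\<close>, so testing it on \<open>Q\<^sub>N\<close> with \<open>v\<close> amounts
  to testing it on \<open>Q\<close> with the folding of \<open>v\<close>.\<close>

lemma periodic_corrector_tested:
  assumes T: "periodic_triangulation h (T :: (real ^ 'd) set set)" and w0: "solves_corrector T 0 Ap p w0"
    and ApL: "in_Linf (LQ N) Ap" "in_Linf (LQ 0) Ap"
    and per: "\<And>k. AE x in LQ 0. Ap (x + ivec k) = Ap x"
    and v: "v \<in> Vper T N"
  shows "(LINT x|LQ N. (Ap x *v (p + grad w0 x)) \<bullet> grad v x) = 0"
proof -
  interpret N: finite_measure "LQ N :: (real ^ 'd) measure" by (rule finite_measure_LQ)
  interpret Q: finite_measure "LQ 0 :: (real ^ 'd) measure" by (rule finite_measure_LQ)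
  have w0V: "w0 \<in> Vper T 0" using w0 by (simp add: solves_corrector_def)
  note gL = Vper_gradient(1)[OF T Vper_0_subset[OF T w0V]] 
  let ?q = "\<lambda>x. Ap x *v (p + grad w0 x)"
  have "(LINT x|LQ N. ?q x \<bullet> grad v x) = (\<Sum>k\<in>cells N. LINT x|LQ 0. ?q (x + ivec k) \<bullet> grad v (x + ivec k))"
    by (intro integral_QN_tiles N.in_Linf_integrable in_Linf_intros ApL gL Vper_gradient(1)[OF T v])
  also have "\<dots> = (\<Sum>k\<in>cells N. LINT x|LQ 0. ?q x \<bullet> grad v (x + ivec k))"
  proof (intro sum.cong refl integral_cong_AE)
    fix k :: "int ^ 'd" assume k: "k \<in> cells N"
    show "AE x in LQ 0. ?q (x + ivec k) \<bullet> grad v (x + ivec k) = ?q x \<bullet> grad v (x + ivec k)"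
      using per[of k] by eventually_elim (simp add: grad_periodic[OF w0V])
    show "(\<lambda>x. ?q x \<bullet> grad v (x + ivec k)) \<in> borel_measurable (LQ 0)"
      by (intro in_Linf_measurable in_Linf_intros ApL gL in_Linf_shift[OF Vper_gradient(1)[OF T v] k])
    have "in_Linf (LQ 0) (\<lambda>x. (\<lambda>x. ?q x \<bullet> grad v x) (x + ivec k))"
      by (rule in_Linf_shift[OF _ k]) (intro in_Linf_intros ApL gL Vper_gradient(1)[OF T v])
    then show "(\<lambda>x. ?q (x + ivec k) \<bullet> grad v (x + ivec k)) \<in> borel_measurable (LQ 0)"
      by (rule in_Linf_measurable)
  qed
  also have "\<dots> = (LINT x|LQ 0. (\<Sum>k\<in>cells N. ?q x \<bullet> grad v (x + ivec k)))"
    by (subst Bochner_Integration.integral_sum)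
      (intro Q.in_Linf_integrable in_Linf_intros ApL gL in_Linf_shift[OF Vper_gradient(1)[OF T v]] | simp)+
  also have "\<dots> = (LINT x|LQ 0. ?q x \<bullet> grad (fold_cells N v) x)"
  proof (intro integral_cong_AE)
    show "AE x in LQ 0. (\<Sum>k\<in>cells N. ?q x \<bullet> grad v (x + ivec k)) = ?q x \<bullet> grad (fold_cells N v) x"
      using grad_fold_cells[OF T v] by eventually_elim (simp add: inner_sum_right)
    show "(\<lambda>x. \<Sum>k\<in>cells N. ?q x \<bullet> grad v (x + ivec k)) \<in> borel_measurable (LQ 0)"
      by (intro in_Linf_measurable in_Linf_sum in_Linf_intros ApL gL in_Linf_shift[OF Vper_gradient(1)[OF T v]])
    show "(\<lambda>x. ?q x \<bullet> grad (fold_cells N v) x) \<in> borel_measurable (LQ 0)"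
      by (intro in_Linf_measurable in_Linf_intros ApL gL Vper_gradient(1)[OF T fold_cells_Vper[OF T v]])
  qed
  also have "\<dots> = 0"
    using w0 fold_cells_Vper[OF T v] by (simp add: solves_corrector_def integral_LQ)
  finally show ?thesis .
qed

section \<open>Correctors for one realization\<close>

lemma corrector_bounds:
  fixes A Ap B1 R :: "real ^ 'd \<Rightarrow> real ^ 'd ^ 'd" and w w0 w1 :: "real ^ 'd \<Rightarrow> real"
    and c m \<eta> :: real
  assumes T: "periodic_triangulation h T"
    and c: "c > 0" and \<eta>: "\<bar>\<eta>\<bar> \<le> 1" "\<eta> \<noteq> 0" and p: "norm p = 1"
    and meas: "in_Linf (LQ N) A" "in_Linf (LQ N) Ap" "in_Linf (LQ N) B1" "in_Linf (LQ N) R"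
    and Ap0: "in_Linf (LQ 0) Ap" and per: "\<And>k. AE x in LQ 0. Ap (x + ivec k) = Ap x"
    and A_coercive: "AE x in LQ N. \<forall>\<xi>. c * (norm \<xi>)\<^sup>2 \<le> \<xi> \<bullet> (A x *v \<xi>)"
    and Ap_coercive: "AE x in LQ N. \<forall>\<xi>. c * (norm \<xi>)\<^sup>2 \<le> \<xi> \<bullet> (Ap x *v \<xi>)"
    and bounds: "AE x in LQ N. norm (A x) \<le> m" "AE x in LQ N. norm (Ap x) \<le> m"
      "AE x in LQ N. norm (B1 x) \<le> m" "AE x in LQ N. norm (R x) \<le> \<eta>\<^sup>2 * m"
    and expansion: "AE x in LQ N. A x = Ap x + \<eta> *\<^sub>R B1 x + R x"
    and w: "solves_corrector T N A p w" and w0: "solves_corrector T 0 Ap p w0"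
    and w1: "solves_corrector1 T N Ap B1 p w0 w1"
  shows corrector_bounds_L2:
      "(LINT x|LQ N. (norm (grad w x - grad w0 x - \<eta> *\<^sub>R grad w1 x))\<^sup>2)
         \<le> source_const c m / c\<^sup>2 * \<eta>^4 * vol (QN N :: (real ^ 'd) set)"
    and corrector_bounds_flux: "norm e = 1 \<Longrightarrow>
      \<bar>(LINT x|LQ N. e \<bullet> (A x *v (p + grad w x)))
         - vol (QN N :: (real ^ 'd) set) * (LINT x|LQ 0. e \<bullet> (Ap x *v (p + grad w0 x)))
         - \<eta> * (LINT x|LQ N. e \<bullet> (Ap x *v grad w1 x)) - \<eta> * (LINT x|LQ N. e \<bullet> (B1 x *v (p + grad w0 x)))\<bar>
       \<le> (1 + m\<^sup>2 + source_const c m + source_const c m / c\<^sup>2) * \<eta>\<^sup>2 * vol (QN N :: (real ^ 'd) set)"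
proof -
  interpret N: finite_measure "LQ N :: (real ^ 'd) measure" by (rule finite_measure_LQ)
  have wV: "w \<in> Vper T N" and w1V: "w1 \<in> Vper T N" and w0V0: "w0 \<in> Vper T 0"
    using w w0 w1 by (auto simp: solves_corrector_def solves_corrector1_def)
  have w0V: "w0 \<in> Vper T N" by (rule Vper_0_subset[OF T w0V0])
  note gL = Vper_gradient(1)[OF T wV] Vper_gradient(1)[OF T w0V] Vper_gradient(1)[OF T w1V]
  note gL0 = Vper_gradient(1)[OF T w0V0]
  define v where "v = (\<lambda>x. w x - w0 x - \<eta> * w1 x)"
  have vV: "v \<in> Vper T N" unfolding v_def by (rule Vper_diff_scale[OF wV w0V w1V])
  have gv: "AE x in LQ N. grad v x = grad w x - grad w0 x - \<eta> *\<^sub>R grad w1 x"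
    using Vper_gradient(2)[OF T wV] Vper_gradient(2)[OF T w0V] Vper_gradient(2)[OF T w1V]
    unfolding v_def by eventually_elim (rule grad_diff_scale)
  have test: "(LINT x|LQ N. f x \<bullet> (grad w x - grad w0 x - \<eta> *\<^sub>R grad w1 x)) = (LINT x|LQ N. f x \<bullet> grad v x)"
    if f: "in_Linf (LQ N) f" for f
  proof (rule integral_cong_AE)
    show "AE x in LQ N. f x \<bullet> (grad w x - grad w0 x - \<eta> *\<^sub>R grad w1 x) = f x \<bullet> grad v x"
      using gv by eventually_elim simp
  qed (rule in_Linf_measurable, intro in_Linf_intros f gL Vper_gradient(1)[OF T vV])+
  have eqw: "(LINT x|LQ N. (A x *v (p + grad w x)) \<bullet> (grad w x - grad w0 x - \<eta> *\<^sub>R grad w1 x)) = 0"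
    using w vV by (subst test) (auto simp: solves_corrector_def integral_LQ intro!: in_Linf_intros meas gL)
  have eq0: "(LINT x|LQ N. (Ap x *v (p + grad w0 x)) \<bullet> (grad w x - grad w0 x - \<eta> *\<^sub>R grad w1 x)) = 0"
    "(LINT x|LQ N. (Ap x *v (p + grad w0 x)) \<bullet> grad w0 x) = 0"
  proof -
    have "in_Linf (LQ N) (\<lambda>x. Ap x *v (p + grad w0 x))"
      by (intro in_Linf_intros meas gL)
    from test[OF this] periodic_corrector_tested[OF T w0 meas(2) Ap0 per vV]
    show "(LINT x|LQ N. (Ap x *v (p + grad w0 x)) \<bullet> (grad w x - grad w0 x - \<eta> *\<^sub>R grad w1 x)) = 0"
      by simp
    show "(LINT x|LQ N. (Ap x *v (p + grad w0 x)) \<bullet> grad w0 x) = 0"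
      by (rule periodic_corrector_tested[OF T w0 meas(2) Ap0 per w0V])
  qed
  have eq1: "(LINT x|LQ N. (Ap x *v grad w1 x) \<bullet> (grad w x - grad w0 x - \<eta> *\<^sub>R grad w1 x))
      + (LINT x|LQ N. (B1 x *v (p + grad w0 x)) \<bullet> (grad w x - grad w0 x - \<eta> *\<^sub>R grad w1 x)) = 0"
    "(LINT x|LQ N. (Ap x *v grad w1 x) \<bullet> grad w1 x) + (LINT x|LQ N. (B1 x *v (p + grad w0 x)) \<bullet> grad w1 x) = 0"
  proof -
    show "(LINT x|LQ N. (Ap x *v grad w1 x) \<bullet> grad w1 x) + (LINT x|LQ N. (B1 x *v (p + grad w0 x)) \<bullet> grad w1 x) = 0"
      using w1 w1V by (simp add: solves_corrector1_def integral_LQ)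
    have "in_Linf (LQ N) (\<lambda>x. Ap x *v grad w1 x)" "in_Linf (LQ N) (\<lambda>x. B1 x *v (p + grad w0 x))"
      by (intro in_Linf_intros meas gL)+
    from this[THEN test] show "(LINT x|LQ N. (Ap x *v grad w1 x) \<bullet> (grad w x - grad w0 x - \<eta> *\<^sub>R grad w1 x))
      + (LINT x|LQ N. (B1 x *v (p + grad w0 x)) \<bullet> (grad w x - grad w0 x - \<eta> *\<^sub>R grad w1 x)) = 0"
      using w1 vV by (simp add: solves_corrector1_def integral_LQ)
  qed
  note prems = c \<eta> p meas gL A_coercive Ap_coercive bounds expansion eqw eq0 eq1
  show "(LINT x|LQ N. (norm (grad w x - grad w0 x - \<eta> *\<^sub>R grad w1 x))\<^sup>2)
         \<le> source_const c m / c\<^sup>2 * \<eta>^4 * vol (QN N :: (real ^ 'd) set)"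
    using N.corrector_expansion_L2[OF prems] by (simp add: measure_LQ)
  assume e: "norm e = 1"
  have "(LINT x|LQ N. e \<bullet> (Ap x *v (p + grad w0 x)))
      = vol (QN N :: (real ^ 'd) set) * (LINT x|LQ 0. e \<bullet> (Ap x *v (p + grad w0 x)))"
  proof (rule integral_QN_periodic)
    have L: "in_Linf (LQ N) (\<lambda>x. e \<bullet> (Ap x *v (p + grad w0 x)))"
      by (intro in_Linf_intros meas gL)
    then show "integrable (LQ N) (\<lambda>x. e \<bullet> (Ap x *v (p + grad w0 x)))"
      by (rule N.in_Linf_integrable)
    show "(\<lambda>x. e \<bullet> (Ap x *v (p + grad w0 x))) \<in> borel_measurable (LQ 0)"
      by (intro in_Linf_measurable in_Linf_intros Ap0 gL0)
    fix k :: "int ^ 'd" assume k: "k \<in> cells N"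
    show "AE x in LQ 0. e \<bullet> (Ap (x + ivec k) *v (p + grad w0 (x + ivec k))) = e \<bullet> (Ap x *v (p + grad w0 x))"
      using per[of k] by eventually_elim (simp add: grad_periodic[OF w0V0])
    show "(\<lambda>x. e \<bullet> (Ap (x + ivec k) *v (p + grad w0 (x + ivec k)))) \<in> borel_measurable (LQ 0)"
      using in_Linf_measurable[OF in_Linf_shift[OF L k]] .
  qed
  with N.corrector_expansion_flux[OF prems e]
  show "\<bar>(LINT x|LQ N. e \<bullet> (A x *v (p + grad w x)))
         - vol (QN N :: (real ^ 'd) set) * (LINT x|LQ 0. e \<bullet> (Ap x *v (p + grad w0 x)))
         - \<eta> * (LINT x|LQ N. e \<bullet> (Ap x *v grad w1 x)) - \<eta> * (LINT x|LQ N. e \<bullet> (B1 x *v (p + grad w0 x)))\<bar>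
       \<le> (1 + m\<^sup>2 + source_const c m + source_const c m / c\<^sup>2) * \<eta>\<^sup>2 * vol (QN N :: (real ^ 'd) set)"
    by (simp add: measure_LQ)
qed

section \<open>Stationary fields\<close>

text \<open>The order matters: for almost every realization, which is the second coordinate, the
  property holds at almost every point of space, which is the first.\<close>

lemma AE_pair_slices:
  assumes "sigma_finite_measure M1" "sigma_finite_measure M2"
    and "AE z in M1 \<Otimes>\<^sub>M M2. Q z"
  shows "AE y in M2. AE x in M1. Q (x, y)"
proof -
  interpret pair_sigma_finite M2 M1
    using assms(1,2) by (simp add: pair_sigma_finite_def)
  interpret S: pair_sigma_finite M1 M2
    using assms(1,2) by (simp add: pair_sigma_finite_def)
  have "AE z in distr (M2 \<Otimes>\<^sub>M M1) (M1 \<Otimes>\<^sub>M M2) (\<lambda>(x, y). (y, x)). Q z"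
    using assms(3) by (subst S.distr_pair_swap[symmetric])
  then have "AE z in M2 \<Otimes>\<^sub>M M1. Q (case z of (x, y) \<Rightarrow> (y, x))"
    by (rule AE_distrD[OF measurable_pair_swap'])
  from AE_pair[OF this] show ?thesis by simp
qed

lemma AE_full_space:
  assumes "prob_space P" "AE (x, \<omega>) in full_space P. Q x \<omega>"
  shows "AE \<omega> in P. AE x in LQ N. Q x \<omega>"
proof -
  interpret prob_space P by fact
  have "AE \<omega> in P. AE x in lborel. Q x \<omega>"
    using AE_pair_slices[OF sigma_finite_lborel sigma_finite_measure_axioms assms(2)] by simp
  then show ?thesis by eventually_elim (rule AE_LQ_I)
qed

lemma AE_cell_space:
  assumes "prob_space P" "AE (x, \<omega>) in cell_space P. Q x \<omega>"
  shows "AE \<omega> in P. AE x in LQ 0. Q x \<omega>"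
proof -
  interpret prob_space P by fact
  have "sigma_finite_measure (restrict_space lborel Q1)"
    by (intro sigma_finite_measure_restrict_space sigma_finite_lborel QN_lebesgue)
  from AE_pair_slices[OF this sigma_finite_measure_axioms assms(2)]
  have "AE \<omega> in P. AE x in restrict_space lborel Q1. Q x \<omega>" by simp
  then show ?thesis
    unfolding AE_LQ by eventually_elim (auto simp: AE_restrict_space_iff QN_def intro!: AE_completion)
qed

lemma stationary_slice_measurable:
  assumes "stationary P \<tau> F" "\<omega> \<in> space P"
  shows "(\<lambda>x. F x \<omega>) \<in> borel_measurable (LQ N)"
proof -
  have "(\<lambda>(x, \<omega>). F x \<omega>) \<in> borel_measurable (lborel \<Otimes>\<^sub>M P)"
    using assms(1) by (simp add: stationary_def)
  from measurable_compose[OF measurable_Pair2'[OF assms(2)] this]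
  have "(\<lambda>x. F x \<omega>) \<in> borel_measurable lborel" by simp
  then show ?thesis by (intro measurable_restrict_space1 measurable_completion)
qed

text \<open>The bound on \<open>Q\<close> is carried to \<open>k + Q\<close> by \<open>F(x + k, \<omega>) = F(x, \<tau>\<^sub>k \<omega>)\<close>, as \<open>\<tau>\<^sub>k\<close> preserves the
  probability.\<close>

lemma stationary_bound:
  assumes "ergodic_lattice_action P \<tau>" and F: "stationary P \<tau> F"
    and cell: "AE z in cell_space P. norm (case z of (x, \<omega>) \<Rightarrow> F x \<omega>) \<le> B"
  shows "AE \<omega> in P. AE x in LQ N. norm (F x \<omega>) \<le> B"
proof -
  interpret ergodic_lattice_action P \<tau> by fact
  have "AE \<omega> in P. AE x in LQ 0. norm (F (x + ivec k) \<omega>) \<le> B" for k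
  proof -
    have "AE \<omega> in P. AE x in LQ 0. norm (F x \<omega>) \<le> B"
      using cell by (intro AE_cell_space prob_space_axioms) (simp add: case_prod_beta')
    then have "AE \<omega> in distr P P (\<tau> k). AE x in LQ 0. norm (F x \<omega>) \<le> B"
      unfolding action_preserves .
    then have "AE \<omega> in P. AE x in LQ 0. norm (F x (\<tau> k \<omega>)) \<le> B"
      by (rule AE_distrD[OF action_measurable])
    moreover have "AE \<omega> in P. AE x in LQ 0. F (x + ivec k) \<omega> = F x (\<tau> k \<omega>)"
      using F by (intro AE_full_space prob_space_axioms) (auto simp: stationary_def)
    ultimately show ?thesis
    proof eventually_elim
      case (elim \<omega>)
      then show ?case by eventually_elim simp
    qed
  qed
  then have "AE \<omega> in P. \<forall>k\<in>cells N. AE x in LQ 0. norm (F (x + ivec k) \<omega>) \<le> B"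
    by (intro AE_finite_allI finite_cells)
  then show ?thesis
    by eventually_elim (rule AE_QN_cells, blast)
qed

lemma norm_matrix_le:
  fixes X :: "real ^ 'd ^ 'd"
  assumes "\<And>i j. \<bar>X $ i $ j\<bar> \<le> b"
  shows "norm X \<le> (real CARD('d))\<^sup>2 * b"
proof -
  have "norm X \<le> (\<Sum>i\<in>UNIV. norm (X $ i))"
    unfolding norm_vec_def[of X] by (rule L2_set_le_sum) simp
  also have "\<dots> \<le> (\<Sum>i\<in>(UNIV :: 'd set). real CARD('d) * b)"
  proof (rule sum_mono)
    fix i
    have "norm (X $ i) \<le> (\<Sum>j\<in>UNIV. \<bar>X $ i $ j\<bar>)" by (rule norm_le_l1_cart)
    also have "\<dots> \<le> (\<Sum>j\<in>(UNIV :: 'd set). b)" by (intro sum_mono assms)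
    finally show "norm (X $ i) \<le> real CARD('d) * b" by simp
  qed
  finally show ?thesis by (simp add: power2_eq_square mult.assoc)
qed

lemma Linf_norm_scaled_le:
  assumes "ennreal (1 / \<eta>\<^sup>2) * L \<le> ennreal C" "\<eta> \<noteq> 0"
  shows "L \<le> ennreal (\<eta>\<^sup>2 * max 0 C)"
proof -
  have "L = ennreal (\<eta>\<^sup>2 * (1 / \<eta>\<^sup>2)) * L" using assms(2) by simp
  also have "\<dots> = ennreal (\<eta>\<^sup>2) * (ennreal (1 / \<eta>\<^sup>2) * L)"
    by (subst ennreal_mult) (auto simp: mult.assoc)
  also have "\<dots> \<le> ennreal (\<eta>\<^sup>2) * ennreal (max 0 C)"
    by (intro mult_left_mono order_trans[OF assms(1)] ennreal_leI) auto
  finally show ?thesis by (simp add: ennreal_mult)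
qed

theorem proposition2p1:
  fixes P :: "'w measure"
    and \<tau> :: "int ^ 'd \<Rightarrow> 'w \<Rightarrow> 'w"
    and A :: "real \<Rightarrow> real ^ 'd \<Rightarrow> 'w \<Rightarrow> real ^ 'd ^ 'd"
    and Aper :: "real ^ 'd \<Rightarrow> real ^ 'd ^ 'd"
    and A1 :: "real ^ 'd \<Rightarrow> 'w \<Rightarrow> real ^ 'd ^ 'd"
    and R :: "real \<Rightarrow> real ^ 'd \<Rightarrow> 'w \<Rightarrow> real ^ 'd ^ 'd"
    and \<gamma> M C\<^sub>R :: real
    and H :: "real set"
    and \<T> :: "real \<Rightarrow> (real ^ 'd) set set"
    and w :: "real \<Rightarrow> real \<Rightarrow> nat \<Rightarrow> real ^ 'd \<Rightarrow> 'w \<Rightarrow> real ^ 'd \<Rightarrow> real"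
    and w0 :: "real \<Rightarrow> real ^ 'd \<Rightarrow> real ^ 'd \<Rightarrow> real"
    and w1 :: "real \<Rightarrow> nat \<Rightarrow> real ^ 'd \<Rightarrow> 'w \<Rightarrow> real ^ 'd \<Rightarrow> real"
    and p :: "real ^ 'd"
  assumes action: "ergodic_lattice_action P \<tau>"
    and A_stationary: "\<And>\<eta>. stationary P \<tau> (A \<eta>)"
    and A_symmetric: "\<And>\<eta>. AE (x, \<omega>) in full_space P. transpose (A \<eta> x \<omega>) = A \<eta> x \<omega>"
    and \<gamma>_pos: "\<gamma> > 0"
    and A_coercive: "\<And>\<eta>. AE (x, \<omega>) in full_space P.
                       \<forall>\<xi>. \<xi> \<bullet> (A \<eta> x \<omega> *v \<xi>) \<ge> \<gamma> * (norm \<xi>)\<^sup>2"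
    and M_pos: "M > 0"
    and A_bounded: "\<And>\<eta>. Linf_norm (full_space P) (\<lambda>(x, \<omega>). A \<eta> x \<omega>) \<le> ennreal M"
    and Aper_periodic: "lattice_periodic_ae Aper"
    and Aper_measurable: "Aper \<in> borel_measurable lborel"
    and Aper_Linf: "in_Linf (restrict_space lborel Q1) Aper"
    and A1_stationary: "stationary P \<tau> A1"
    and A1_Linf: "in_Linf (cell_space P) (\<lambda>(x, \<omega>). A1 x \<omega>)"
    and R_stationary: "\<And>\<eta>. stationary P \<tau> (R \<eta>)"
    and expansion: "\<And>\<eta>. AE (x, \<omega>) in full_space P.
                      A \<eta> x \<omega> = Aper x + \<eta> *\<^sub>R A1 x \<omega> + R \<eta> x \<omega>"
    and limit0: "((\<lambda>\<eta>. Linf_norm (cell_space P) (\<lambda>(x, \<omega>). A \<eta> x \<omega> - Aper x)) \<longlongrightarrow> 0) (at 0)"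
    and limit1: "((\<lambda>\<eta>. Linf_norm (cell_space P)
                    (\<lambda>(x, \<omega>). (1 / \<eta>) *\<^sub>R (A \<eta> x \<omega> - Aper x) - A1 x \<omega>)) \<longlongrightarrow> 0) (at 0)"
    and remainder: "\<And>\<eta>. \<bar>\<eta>\<bar> \<le> 1 \<Longrightarrow> \<eta> \<noteq> 0 \<Longrightarrow>
                      ennreal (1 / \<eta>\<^sup>2) * Linf_norm (cell_space P) (\<lambda>(x, \<omega>). R \<eta> x \<omega>) \<le> ennreal C\<^sub>R"
    and meshes: "\<And>h. h \<in> H \<Longrightarrow> periodic_triangulation h (\<T> h)"
    and w_corrector: "\<And>\<eta> h N q. h \<in> H \<Longrightarrow>
          AE \<omega> in P. solves_corrector (\<T> h) N (\<lambda>x. A \<eta> x \<omega>) q (w \<eta> h N q \<omega>)"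
    and w0_corrector: "\<And>h q. h \<in> H \<Longrightarrow> solves_corrector (\<T> h) 0 Aper q (w0 h q)"
    and w1_corrector: "\<And>h N q. h \<in> H \<Longrightarrow>
          AE \<omega> in P. solves_corrector1 (\<T> h) N Aper (\<lambda>x. A1 x \<omega>) q (w0 h q) (w1 h N q \<omega>)"
    and p_unit: "norm p = 1"
  shows "\<exists>C. \<forall>\<eta> N. \<forall>h\<in>H. \<bar>\<eta>\<bar> \<le> 1 \<and> \<eta> \<noteq> 0 \<longrightarrow>
           (AE \<omega> in P. 1 / \<eta>\<^sup>2 *
              L2_norm_on (QN N)
                (\<lambda>x. grad (w \<eta> h N p \<omega>) x - grad (w0 h p) x - \<eta> *\<^sub>R grad (w1 h N p \<omega>) x)
              \<le> C * sqrt (vol (QN N :: (real ^ 'd) set))) \<and>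
           (AE \<omega> in P. 1 / \<eta>\<^sup>2 *
              norm (hom_eta N (\<lambda>x. A \<eta> x \<omega>) (\<lambda>q. w \<eta> h N q \<omega>) - hom_per Aper (w0 h)
                    - \<eta> *\<^sub>R hom_1 N Aper (\<lambda>x. A1 x \<omega>) (w0 h) (\<lambda>q. w1 h N q \<omega>))
              \<le> C)"
proof -
  interpret ergodic_lattice_action P \<tau> by (rule action)
  note prob = prob_space_axioms
  define M1 where "M1 = enn2real (Linf_norm (cell_space P) (\<lambda>(x, \<omega>). A1 x \<omega>))"
  define CR where "CR = max 0 C\<^sub>R"
  define m where "m = M + M1 + CR"
  define c where "c = \<gamma> / 2"
  define K where "K = 1 + m\<^sup>2 + source_const c m + source_const c m / c\<^sup>2"
  define C where "C = sqrt (source_const c m / c\<^sup>2) + (real CARD('d))\<^sup>2 * K"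
  have M1: "M1 \<ge> 0" and CR: "CR \<ge> 0" by (simp_all add: M1_def CR_def)
  have c: "c > 0" using \<gamma>_pos by (simp add: c_def)
  have s: "source_const c m \<ge> 0" by (simp add: source_const_def Let_def)
  have s': "source_const c m / c\<^sup>2 \<ge> 0" by (intro divide_nonneg_nonneg s) simp
  have K: "K \<ge> 0" unfolding K_def by (intro add_nonneg_nonneg s s') auto
  have A_le: "AE \<omega> in P. AE x in LQ N. norm (A \<eta> x \<omega>) \<le> M" for \<eta> N
    using Linf_norm_AE[OF A_bounded[of \<eta>]] M_pos by (intro AE_full_space prob) (simp add: case_prod_beta')
  have A1_le: "AE \<omega> in P. AE x in LQ N. norm (A1 x \<omega>) \<le> M1" for N
  proof (rule stationary_bound[OF action A1_stationary])
    have "Linf_norm (cell_space P) (\<lambda>(x, \<omega>). A1 x \<omega>) \<le> ennreal M1"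
      using A1_Linf by (simp add: M1_def in_Linf_def)
    from Linf_norm_AE[OF this] show "AE z in cell_space P. norm (case z of (x, \<omega>) \<Rightarrow> A1 x \<omega>) \<le> M1"
      using M1 by simp
  qed
  have R_le: "AE \<omega> in P. AE x in LQ N. norm (R \<eta> x \<omega>) \<le> \<eta>\<^sup>2 * CR" if "\<bar>\<eta>\<bar> \<le> 1" "\<eta> \<noteq> 0" for \<eta> N
  proof (rule stationary_bound[OF action R_stationary])
    from Linf_norm_AE[OF Linf_norm_scaled_le[OF remainder[OF that] that(2)]]
    show "AE z in cell_space P. norm (case z of (x, \<omega>) \<Rightarrow> R \<eta> x \<omega>) \<le> \<eta>\<^sup>2 * CR"
      by (simp add: CR_def)
  qed
  have exp: "AE \<omega> in P. AE x in LQ N. A \<eta> x \<omega> = Aper x + \<eta> *\<^sub>R A1 x \<omega> + R \<eta> x \<omega>" for \<eta> N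
    by (rule AE_full_space[OF prob expansion])
  have coer: "AE \<omega> in P. AE x in LQ N. \<forall>\<xi>. \<gamma> * (norm \<xi>)\<^sup>2 \<le> \<xi> \<bullet> (A \<eta> x \<omega> *v \<xi>)" for \<eta> N
    by (rule AE_full_space[OF prob A_coercive])
  \<comment> \<open>a parameter for which \<open>\<epsilon> A\<^sub>1 + R\<^sub>\<epsilon>\<close> is bounded by \<open>\<gamma> / 2\<close>, so that the coercivity of \<open>A\<^sub>\<epsilon>\<close>
    passes to the periodic matrix\<close>
  define \<epsilon> where "\<epsilon> = min 1 (\<gamma> / (2 * (M1 + CR + 1)))"
  have \<epsilon>: "0 < \<epsilon>" "\<epsilon> \<le> 1" using \<gamma>_pos M1 CR by (simp_all add: \<epsilon>_def)
  have "\<epsilon> * (M1 + CR) \<le> \<epsilon> * (M1 + CR + 1)" using \<epsilon>(1) by simp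
  also have "\<dots> \<le> \<gamma> / (2 * (M1 + CR + 1)) * (M1 + CR + 1)"
    using M1 CR by (intro mult_right_mono) (auto simp: \<epsilon>_def)
  also have "\<dots> = \<gamma> / 2"
  proof -
    have "\<gamma> / (2 * t) * t = \<gamma> / 2" if "t > 0" for t :: real using that by simp
    from this[of "M1 + CR + 1"] show ?thesis using M1 CR by linarith
  qed
  finally have \<epsilon>_small: "\<epsilon> * (M1 + CR) \<le> \<gamma> / 2" .
  have Aper_props: "AE x in LQ N. norm (Aper x) \<le> m \<and> (\<forall>\<xi>. c * (norm \<xi>)\<^sup>2 \<le> \<xi> \<bullet> (Aper x *v \<xi>))" for N
  proof -
    have "AE \<omega> in P. AE x in LQ N. norm (R \<epsilon> x \<omega>) \<le> \<epsilon>\<^sup>2 * CR"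
      using \<epsilon> by (intro R_le) auto
    with A_le[of \<epsilon> N] A1_le[of N] exp[of \<epsilon> N] coer[of \<epsilon> N]
    have "AE \<omega> in P. AE x in LQ N. norm (Aper x) \<le> m \<and> (\<forall>\<xi>. c * (norm \<xi>)\<^sup>2 \<le> \<xi> \<bullet> (Aper x *v \<xi>))"
    proof eventually_elim
      case (elim \<omega>)
      then show ?case
      proof eventually_elim
        case (elim x)
        define D where "D = \<epsilon> *\<^sub>R A1 x \<omega> + R \<epsilon> x \<omega>"
        have A: "A \<epsilon> x \<omega> = Aper x + D" using elim(3) by (simp add: D_def add.assoc)
        have "norm D \<le> \<epsilon> * norm (A1 x \<omega>) + norm (R \<epsilon> x \<omega>)"
          unfolding D_def using norm_triangle_ineq[of "\<epsilon> *\<^sub>R A1 x \<omega>" "R \<epsilon> x \<omega>"] \<epsilon>(1) by simp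
        also have "\<dots> \<le> \<epsilon> * M1 + \<epsilon>\<^sup>2 * CR"
          using elim(2,5) \<epsilon>(1) by (intro add_mono mult_left_mono) auto
        also have "\<epsilon>\<^sup>2 * CR \<le> \<epsilon> * CR"
          using \<epsilon> CR by (intro mult_right_mono) (auto simp: power2_eq_square mult_left_le)
        finally have D: "norm D \<le> \<epsilon> * (M1 + CR)" by (simp add: distrib_left)
        moreover have "\<epsilon> * (M1 + CR) \<le> 1 * (M1 + CR)" using \<epsilon> M1 CR by (intro mult_right_mono) auto
        moreover have "norm (Aper x) \<le> norm (A \<epsilon> x \<omega>) + norm D"
          using norm_triangle_ineq4[of "A \<epsilon> x \<omega>" D] by (simp add: A)
        ultimately have "norm (Aper x) \<le> m" using elim(1) by (simp add: m_def)
        moreover have "c * (norm \<xi>)\<^sup>2 \<le> \<xi> \<bullet> (Aper x *v \<xi>)" for \<xi>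
        proof -
          have "\<xi> \<bullet> (D *v \<xi>) \<le> norm \<xi> * norm (D *v \<xi>)" by (rule norm_cauchy_schwarz)
          also have "\<dots> \<le> norm \<xi> * (\<gamma> / 2 * norm \<xi>)"
            using D \<epsilon>_small by (intro mult_left_mono norm_matrix_vector_bound) auto
          finally have "\<xi> \<bullet> (D *v \<xi>) \<le> \<gamma> / 2 * (norm \<xi>)\<^sup>2" by (simp add: power2_eq_square mult_ac)
          moreover have "\<gamma> * (norm \<xi>)\<^sup>2 \<le> \<xi> \<bullet> (Aper x *v \<xi>) + \<xi> \<bullet> (D *v \<xi>)"
            using elim(4)[rule_format, of \<xi>] by (simp add: A matrix_vector_mult_add_rdistrib inner_add_right)
          ultimately show ?thesis by (simp add: c_def)
        qed
        ultimately show ?case by blast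
      qed
    qed
    \<comment> \<open>the inner statement does not depend on \<open>\<omega>\<close>\<close>
    then show ?thesis by simp
  qed
  have Aper_meas: "in_Linf (LQ N) Aper" for N
  proof -
    have "Aper \<in> borel_measurable (LQ N)"
      by (intro measurable_restrict_space1 measurable_completion Aper_measurable)
    then show ?thesis using Aper_props[of N] by (auto simp: in_Linf_iff elim: eventually_mono)
  qed
  have per: "AE x in LQ 0. Aper (x + ivec k) = Aper x" for k
    using Aper_periodic by (intro AE_LQ_I) (simp add: lattice_periodic_ae_def)
  have core: "AE \<omega> in P. (LINT x|LQ N. (norm (grad (w \<eta> h N q \<omega>) x - grad (w0 h q) x - \<eta> *\<^sub>R grad (w1 h N q \<omega>) x))\<^sup>2)
         \<le> source_const c m / c\<^sup>2 * \<eta>^4 * vol (QN N :: (real ^ 'd) set)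
      \<and> (\<forall>e. norm e = 1 \<longrightarrow>
      \<bar>(LINT x|LQ N. e \<bullet> (A \<eta> x \<omega> *v (q + grad (w \<eta> h N q \<omega>) x)))
         - vol (QN N :: (real ^ 'd) set) * (LINT x|LQ 0. e \<bullet> (Aper x *v (q + grad (w0 h q) x)))
         - \<eta> * (LINT x|LQ N. e \<bullet> (Aper x *v grad (w1 h N q \<omega>) x))
         - \<eta> * (LINT x|LQ N. e \<bullet> (A1 x \<omega> *v (q + grad (w0 h q) x)))\<bar>
       \<le> K * \<eta>\<^sup>2 * vol (QN N :: (real ^ 'd) set))"
    if h: "h \<in> H" and \<eta>: "\<bar>\<eta>\<bar> \<le> 1" "\<eta> \<noteq> 0" and q: "norm q = 1" for \<eta> N h q
    using A_le[of \<eta> N] A1_le[of N] R_le[OF \<eta>, of N] exp[of \<eta> N] coer[of \<eta> N]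
      w_corrector[OF h, where N = N and \<eta> = \<eta> and q = q] w1_corrector[OF h, where N = N and q = q] AE_space
  proof eventually_elim
    case (elim \<omega>)
    have bA: "AE x in LQ N. norm (A \<eta> x \<omega>) \<le> m"
      using elim(1) by eventually_elim (use M1 CR in \<open>simp add: m_def\<close>)
    have b1: "AE x in LQ N. norm (A1 x \<omega>) \<le> m"
      using elim(2) by eventually_elim (use M_pos CR in \<open>simp add: m_def\<close>)
    have bR: "AE x in LQ N. norm (R \<eta> x \<omega>) \<le> \<eta>\<^sup>2 * m"
      using elim(3)
    proof eventually_elim
      case (elim x)
      have "\<eta>\<^sup>2 * CR \<le> \<eta>\<^sup>2 * m" using M_pos M1 by (intro mult_left_mono) (auto simp: m_def)
      with elim show ?case by linarith
    qed
    have L: "in_Linf (LQ N) (\<lambda>x. A \<eta> x \<omega>)" "in_Linf (LQ N) (\<lambda>x. A1 x \<omega>)" "in_Linf (LQ N) (\<lambda>x. R \<eta> x \<omega>)"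
      using stationary_slice_measurable[OF A_stationary elim(8)] stationary_slice_measurable[OF A1_stationary elim(8)]
        stationary_slice_measurable[OF R_stationary elim(8)] bA b1 bR by (auto simp: in_Linf_iff)
    have cA: "AE x in LQ N. \<forall>\<xi>. c * (norm \<xi>)\<^sup>2 \<le> \<xi> \<bullet> (A \<eta> x \<omega> *v \<xi>)"
      using elim(5)
    proof eventually_elim
      case (elim x)
      have "c * (norm \<xi>)\<^sup>2 \<le> \<gamma> * (norm \<xi>)\<^sup>2" for \<xi> :: "real ^ 'd"
        using \<gamma>_pos by (intro mult_right_mono) (auto simp: c_def)
      with elim show ?case by (meson order_trans)
    qed
    have bP: "AE x in LQ N. norm (Aper x) \<le> m"
      and cP: "AE x in LQ N. \<forall>\<xi>. c * (norm \<xi>)\<^sup>2 \<le> \<xi> \<bullet> (Aper x *v \<xi>)"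
      using Aper_props[of N] by (auto elim: eventually_mono)
    note prems = meshes[OF h] c \<eta> q L(1) Aper_meas L(2,3) Aper_meas per cA cP bA bP b1 bR elim(4)
      elim(6) w0_corrector[OF h] elim(7)
    show ?case
      using corrector_bounds_L2[OF prems] corrector_bounds_flux[OF prems] unfolding K_def by blast
  qed
  show ?thesis
  proof (intro exI[of _ C] allI ballI impI conjI)
    fix \<eta> :: real and N and h assume h: "h \<in> H" and "\<bar>\<eta>\<bar> \<le> 1 \<and> \<eta> \<noteq> 0"
    then have \<eta>: "\<bar>\<eta>\<bar> \<le> 1" "\<eta> \<noteq> 0" by auto
    define V where "V = vol (QN N :: (real ^ 'd) set)"
    have V: "V > 0" unfolding V_def by (rule vol_pos)
    show "AE \<omega> in P. 1 / \<eta>\<^sup>2 * L2_norm_on (QN N)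
          (\<lambda>x. grad (w \<eta> h N p \<omega>) x - grad (w0 h p) x - \<eta> *\<^sub>R grad (w1 h N p \<omega>) x)
        \<le> C * sqrt (vol (QN N :: (real ^ 'd) set))"
      using core[OF h \<eta> p_unit, of N]
    proof eventually_elim
      case (elim \<omega>)
      have "L2_norm_on (QN N) (\<lambda>x. grad (w \<eta> h N p \<omega>) x - grad (w0 h p) x - \<eta> *\<^sub>R grad (w1 h N p \<omega>) x)
          \<le> sqrt (source_const c m / c\<^sup>2 * \<eta>^4 * V)"
        unfolding L2_norm_on_def integral_LQ V_def using elim by (intro real_sqrt_le_mono) blast
      also have "\<dots> = sqrt (source_const c m / c\<^sup>2) * \<eta>\<^sup>2 * sqrt V"
      proof -
        have "sqrt (\<eta>^4) = \<eta>\<^sup>2"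
          using real_sqrt_abs[of "\<eta>\<^sup>2"] by (simp flip: power_mult)
        then show ?thesis by (simp only: real_sqrt_mult)
      qed
      also have "\<dots> \<le> C * \<eta>\<^sup>2 * sqrt V"
        using K V by (intro mult_right_mono) (auto simp: C_def)
      finally show ?case using \<eta>(2) by (simp add: V_def field_simps)
    qed
    have "AE \<omega> in P. \<forall>j :: 'd. \<forall>e. norm e = 1 \<longrightarrow>
      \<bar>(LINT x|LQ N. e \<bullet> (A \<eta> x \<omega> *v (axis j 1 + grad (w \<eta> h N (axis j 1) \<omega>) x)))
         - V * (LINT x|LQ 0. e \<bullet> (Aper x *v (axis j 1 + grad (w0 h (axis j 1)) x)))
         - \<eta> * (LINT x|LQ N. e \<bullet> (Aper x *v grad (w1 h N (axis j 1) \<omega>) x))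
         - \<eta> * (LINT x|LQ N. e \<bullet> (A1 x \<omega> *v (axis j 1 + grad (w0 h (axis j 1)) x)))\<bar>
       \<le> K * \<eta>\<^sup>2 * V"
    proof -
      have "AE \<omega> in P. \<forall>e. norm e = 1 \<longrightarrow>
      \<bar>(LINT x|LQ N. e \<bullet> (A \<eta> x \<omega> *v (axis j 1 + grad (w \<eta> h N (axis j 1) \<omega>) x)))
         - V * (LINT x|LQ 0. e \<bullet> (Aper x *v (axis j 1 + grad (w0 h (axis j 1)) x)))
         - \<eta> * (LINT x|LQ N. e \<bullet> (Aper x *v grad (w1 h N (axis j 1) \<omega>) x))
         - \<eta> * (LINT x|LQ N. e \<bullet> (A1 x \<omega> *v (axis j 1 + grad (w0 h (axis j 1)) x)))\<bar>
       \<le> K * \<eta>\<^sup>2 * V" for j :: 'd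
      proof -
        have "norm (axis j 1 :: real ^ 'd) = 1" by simp
        from core[OF h \<eta> this, of N] show ?thesis unfolding V_def by (rule eventually_mono) blast
      qed
      then show ?thesis by (subst AE_all_countable) blast
    qed
    then show "AE \<omega> in P. 1 / \<eta>\<^sup>2 *
        norm (hom_eta N (\<lambda>x. A \<eta> x \<omega>) (\<lambda>q. w \<eta> h N q \<omega>) - hom_per Aper (w0 h)
              - \<eta> *\<^sub>R hom_1 N Aper (\<lambda>x. A1 x \<omega>) (w0 h) (\<lambda>q. w1 h N q \<omega>)) \<le> C"
    proof eventually_elim
      case (elim \<omega>)
      let ?X = "hom_eta N (\<lambda>x. A \<eta> x \<omega>) (\<lambda>q. w \<eta> h N q \<omega>) - hom_per Aper (w0 h)
              - \<eta> *\<^sub>R hom_1 N Aper (\<lambda>x. A1 x \<omega>) (w0 h) (\<lambda>q. w1 h N q \<omega>)"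
      have "\<bar>?X $ i $ j\<bar> \<le> K * \<eta>\<^sup>2" for i j
      proof -
        define I1 where "I1 = (LINT x|LQ N. axis i 1 \<bullet> (A \<eta> x \<omega> *v (axis j 1 + grad (w \<eta> h N (axis j 1) \<omega>) x)))"
        define I2 where "I2 = (LINT x|LQ 0. axis i 1 \<bullet> (Aper x *v (axis j 1 + grad (w0 h (axis j 1)) x)))"
        define I3 where "I3 = (LINT x|LQ N. axis i 1 \<bullet> (Aper x *v grad (w1 h N (axis j 1) \<omega>) x))"
        define I4 where "I4 = (LINT x|LQ N. axis i 1 \<bullet> (A1 x \<omega> *v (axis j 1 + grad (w0 h (axis j 1)) x)))"
        have b: "\<bar>I1 - V * I2 - \<eta> * I3 - \<eta> * I4\<bar> \<le> K * \<eta>\<^sup>2 * V"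
          using elim[rule_format, of "axis i 1" j] unfolding I1_def I2_def I3_def I4_def by simp
        have "?X $ i $ j = 1 / V * I1 - I2 - \<eta> * (1 / V * I3 + 1 / V * I4)"
          unfolding I1_def I2_def I3_def I4_def V_def
          by (simp add: hom_eta_def hom_per_def hom_1_def integral_LQ add.commute[of _ "axis j 1"])
        also have "\<dots> = (I1 - V * I2 - \<eta> * I3 - \<eta> * I4) / V"
          using V by (simp add: field_simps)
        finally show ?thesis using b V by (simp add: abs_divide pos_divide_le_eq)
      qed
      then have "norm ?X \<le> (real CARD('d))\<^sup>2 * (K * \<eta>\<^sup>2)" by (rule norm_matrix_le)
      then have "1 / \<eta>\<^sup>2 * norm ?X \<le> (real CARD('d))\<^sup>2 * K"
        using \<eta>(2) by (simp add: field_simps)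
      also have "\<dots> \<le> C" using s' by (simp add: C_def)
      finally show ?case .
    qed
  qed
qed

end
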